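(* (Wall crossing formula.) Let $\mathcal P=(\Delta,\mathcal F)$ be a simple multi-polytope of dimension $n>1$. Let $F$ be one of the $F_i$'s. Let $u_\alpha$ and $u_\beta$ be elements of $V^*\setminus\bigcup_{i=1}^dF_i$ such that the segment from $u_\alpha$ to $u_\beta$ intersects the wall $F$ transversely at $\mu$, and does not intersect any other $F_j\ne F$. Then $$\mathrm{DH}_{\mathcal P}(u_\alpha)-\mathrm{DH}_{\mathcal P}(u_\beta)=\sum_{i:F_i=F}\mathrm{sign}\langle u_\beta-u_\alpha,v_i\rangle\,\mathrm{DH}_{\mathcal P_i}(\mu-f_i).$$
   Context: **Multi-fans.** Let $N$ be a lattice of rank $n$ and $N_{\mathbb R}=N\otimes\mathbb R$. A cone in $N$ is a strongly convex rational polyhedral cone in $N_{\mathbb R}$ (the set of nonnegative real combinations of finitely many vectors of $N$, containing no line). $\mathrm{Cone}(N)$ is the set of all cones, partially ordered by $\tau\prec\sigma$ iff $\tau$ is a proper face of $\sigma$. A multi-fan of dimension $n$ in $N$ is a triple $\Delta=(\Sigma,C,w^{\pm})$ where $\Sigma$ is a finite partially ordered set with a unique minimum element $*$; $C:\Sigma\to\mathrm{Cone}(N)$ is a map with (1) $C( * )=\{0\}$, (2) $I<J$ implies $C(I)\prec C(J)$, (3) for each $J\in\Sigma$, $C$ restricts to an isomorphism of ordered sets from $\{I\in\Sigma: I\le J\}$ onto $\{\kappa\in\mathrm{Cone}(N):\kappa\preceq C(J)\}$; and, with $\Sigma^{(m)}=\{I\in\Sigma:\dim C(I)=m\}$ (write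 $|I|=m$ for $I\in\Sigma^{(m)}$), $w^+,w^-:\Sigma^{(n)}\to\mathbb Z_{\ge0}$ are functions such that $w^+(I)>0$ or $w^-(I)>0$ for each $I$. Put $w=w^+-w^-$. A vector $v\in N_{\mathbb R}$ is generic if it lies on no linear subspace spanned by a cone $C(I)$ of dimension $<n$. $\Delta$ is pre-complete if $\Sigma^{(n)}\ne\emptyset$ and $d_v=\sum_{v\in C(I),\,I\in\Sigma^{(n)}}w(I)$ is independent of the generic vector $v$. For $K\in\Sigma$ the projected multi-fan $\Delta_K=(\Sigma_K,C_K,w_K^\pm)$ has $\Sigma_K=\{J\in\Sigma:K\le J\}$, $C_K(J)$ = the image of $C(J)$ in the quotient of $N_{\mathbb R}$ by the span of $C(K)$ (with lattice the quotient of $N$ by the subgroup generated by $C(K)\cap N$), and $w_K^\pm$ the restrictions of $w^\pm$. $\Delta$ is complete if $\Delta$ and all $\Delta_K$, $K\in\Sigma$, are pre-complete. $\Delta$ is simplicial if every $C(I)$ is generated by linearly independent vectors; then $\Sigma$ is identified with an augmented simplicial set (abstract simplicial complex including the empty set as minimum) of subsets of $\{1,\dots,d\}$ with $\Sigma^{(1)}=\{\{1\},\dots,\{d\}\}$, and $|I|$ is the cardinality of $I$; elements $J\ni i$ of $\Sigma_{\{i\}}$ are identified with $J\setminus\{i\}$. **Multi-polytopes.** Put $V=N_{\mathbb R}$, $V^*=\mathrm{Hom}(V,\mathbb R)$. A multi-polytope is a pair $\mathcal P=(\Delta,\mathcal F)$ where $\Delta$ is a complete multi-fan and $\mathcal F$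 assigns to each $I\in\Sigma^{(1)}$ an affine hyperplane $\mathcal F(I)\subset V^*$ on which the elements of $C(I)$ are constant; its dimension is that of $\Delta$. It is simple if $\Delta$ is simplicial. For simple $\mathcal P$ let $v_i$ be a nonzero vector in $C(\{i\})$, $F_i=\mathcal F(\{i\})$. For $I\in\Sigma^{(n)}$, $\bigcap_{i\in I}F_i$ is a point $u_I$; let $\{u_i^I\}_{i\in I}\subset V^*$ be the basis dual to $\{v_i\}_{i\in I}$. **Duistermaat-Heckman function.** Fix a generic $v\in V$. For $I\in\Sigma^{(n)}$ put $(-1)^I=(-1)^{\sharp\{i\in I:\langle u_i^I,v\rangle>0\}}$, $(u_i^I)^+=u_i^I$ if $\langle u_i^I,v\rangle>0$ and $-u_i^I$ if $\langle u_i^I,v\rangle<0$; let $\phi_I$ be the characteristic function of the cone with apex $u_I$ spanned by the $(u_i^I)^+$, $i\in I$. Then $\mathrm{DH}_{\mathcal P}=\sum_{I\in\Sigma^{(n)}}(-1)^Iw(I)\phi_I$ on $V^*\setminus\bigcup_iF_i$. **The multi-polytopes $\mathcal P_i$.** Assume $n>1$. For $\{i\}\in\Sigma^{(1)}$ write $\Delta_i=\Delta_{\{i\}}$, a complete simplicial multi-fan in $V/V_i$ with $V_i=\mathbb Rv_i$. Identify $(V/V_i)^*$ with $(V^* )_i=\{u\in V^*:\langle u,v_i\rangle=0\}$, choose an arbitrary $f_i\in F_i$, and let $\mathcal F_i$ assign to each $\{j\}\in\Sigma_{\{i\}}^{(1)}$ (i.e. $\{i,j\}\in\Sigma^{(2)}$)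 the affine hyperplane $(F_i\cap F_j)-f_i$ of $(V^* )_i$. Then $\mathcal P_i=(\Delta_i,\mathcal F_i)$ is a simple multi-polytope of dimension $n-1$, and $\mathrm{DH}_{\mathcal P_i}$ is its Duistermaat-Heckman function, defined using the image $\bar v\in V/V_i$ of the generic vector $v$ used for $\mathrm{DH}_{\mathcal P}$. Explicitly, the elements of $\Sigma_{\{i\}}^{(n-1)}$ are the sets $J=I\setminus\{i\}$ with $i\in I\in\Sigma^{(n)}$; for such $J$ the basis of $(V/V_i)^*\cong(V^* )_i$ dual to the images of $v_j$ $(j\in J)$ in $V/V_i$ is $\{u_j^I\}_{j\in J}$, with $\langle u_j^I,\bar v\rangle=\langle u_j^I,v\rangle\ne0$, and the corresponding vertex of $\mathcal P_i$ is $u_I-f_i$. Put $(-1)^J=(-1)^{\sharp\{j\in J:\langle u_j^I,\bar v\rangle>0\}}$, $(u_j^I)^+=u_j^I$ if $\langle u_j^I,\bar v\rangle>0$ and $-u_j^I$ if $\langle u_j^I,\bar v\rangle<0$, and let $\phi_J$ be the characteristic function of the cone in $(V^* )_i$ with apex $u_I-f_i$ spanned by the $(u_j^I)^+$, $j\in J$. Then $\mathrm{DH}_{\mathcal P_i}=\sum_{J\in\Sigma_{\{i\}}^{(n-1)}}(-1)^Jw(J\cup\{i\})\phi_J$ on $(V^* )_i\setminus\bigcup_{j:\{i,j\}\in\Sigma^{(2)}}\bigl((F_i\cap F_j)-f_i\bigr)$. *)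

theory Defs
  imports "HOL-Analysis.Analysis"
begin

section \<open>Lattices and cones\<close>

text \<open>A lattice \<open>N\<close> is realised inside a Euclidean space, as the integer span of a linearly
  independent set; then \<open>N \<otimes> \<real>\<close> is \<open>span N\<close> and the rank of \<open>N\<close> is \<open>dim N\<close>. The inner product of
  the ambient space serves only to provide concrete models of quotient spaces and of their duals
  (see \<open>quot_map\<close> and \<open>dual_space\<close>).\<close>

definition is_lattice :: "'a::euclidean_space set \<Rightarrow> bool" where
  "is_lattice N \<longleftrightarrow> (\<exists>B. independent B \<and> N = {\<Sum>b\<in>B. of_int (k b) *\<^sub>R b | k :: 'a \<Rightarrow> int. True})"

text \<open>In particular \<open>convex_cone hull {}\<close> is \<open>{0}\<close>.\<close>

definition Cone :: "'a::euclidean_space set \<Rightarrow> 'a set set" where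
  "Cone N = {\<sigma>. (\<exists>S. finite S \<and> S \<subseteq> N \<and> \<sigma> = convex_cone hull S) \<and>
                \<not> (\<exists>a d. d \<noteq> 0 \<and> range (\<lambda>t::real. a + t *\<^sub>R d) \<subseteq> \<sigma>)}"

text \<open>Cones are nonempty, so on \<open>Cone N\<close> the library's \<open>face_of\<close> (which also admits the empty
  face) is the usual face relation.\<close>


section \<open>Multi-fans\<close>

text \<open>\<open>mf_ord\<close> is the order relation on the index poset \<open>mf_set\<close>. The functions \<open>mf_cone\<close>, \<open>mf_wpos\<close>
  and \<open>mf_wneg\<close> are relevant only on \<open>mf_set\<close>, respectively on its top-dimensional elements.\<close>

record ('i, 'a) multi_fan =
  mf_lattice :: "'a set"
  mf_set :: "'i set"
  mf_ord :: "('i \<times> 'i) set"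
  mf_cone :: "'i \<Rightarrow> 'a set"
  mf_wpos :: "'i \<Rightarrow> nat"
  mf_wneg :: "'i \<Rightarrow> nat"

definition mf_space :: "('i, 'a::euclidean_space) multi_fan \<Rightarrow> 'a set" where
  "mf_space \<Delta> = span (mf_lattice \<Delta>)"

definition mf_dim :: "('i, 'a::euclidean_space) multi_fan \<Rightarrow> nat" where
  "mf_dim \<Delta> = dim (mf_space \<Delta>)"

definition mf_level :: "('i, 'a::euclidean_space) multi_fan \<Rightarrow> nat \<Rightarrow> 'i set" where
  "mf_level \<Delta> m = {I \<in> mf_set \<Delta>. dim (mf_cone \<Delta> I) = m}"

definition mf_weight :: "('i, 'a) multi_fan \<Rightarrow> 'i \<Rightarrow> int" where
  "mf_weight \<Delta> I = int (mf_wpos \<Delta> I) - int (mf_wneg \<Delta> I)"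

definition is_multi_fan :: "('i, 'a::euclidean_space) multi_fan \<Rightarrow> bool" where
  "is_multi_fan \<Delta> \<longleftrightarrow>
     is_lattice (mf_lattice \<Delta>) \<and>
     finite (mf_set \<Delta>) \<and>
     partial_order_on (mf_set \<Delta>) (mf_ord \<Delta>) \<and>
     (\<exists>z \<in> mf_set \<Delta>. (\<forall>J \<in> mf_set \<Delta>. (z, J) \<in> mf_ord \<Delta>) \<and> mf_cone \<Delta> z = {0}) \<and>
     mf_cone \<Delta> ` mf_set \<Delta> \<subseteq> Cone (mf_lattice \<Delta>) \<and>
     (\<forall>I J. (I, J) \<in> mf_ord \<Delta> \<and> I \<noteq> J \<longrightarrow>
        mf_cone \<Delta> I face_of mf_cone \<Delta> J \<and> mf_cone \<Delta> I \<noteq> mf_cone \<Delta> J) \<and>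
     (\<forall>J \<in> mf_set \<Delta>.
        bij_betw (mf_cone \<Delta>) {I. (I, J) \<in> mf_ord \<Delta>}
          {\<kappa> \<in> Cone (mf_lattice \<Delta>). \<kappa> face_of mf_cone \<Delta> J} \<and>
        (\<forall>I I'. (I, J) \<in> mf_ord \<Delta> \<and> (I', J) \<in> mf_ord \<Delta> \<longrightarrow>
           ((I, I') \<in> mf_ord \<Delta> \<longleftrightarrow> mf_cone \<Delta> I face_of mf_cone \<Delta> I'))) \<and>
     (\<forall>I \<in> mf_level \<Delta> (mf_dim \<Delta>). mf_wpos \<Delta> I > 0 \<or> mf_wneg \<Delta> I > 0)"

definition generic :: "('i, 'a::euclidean_space) multi_fan \<Rightarrow> 'a \<Rightarrow> bool" where
  "generic \<Delta> v \<longleftrightarrow> v \<in> mf_space \<Delta> \<and>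
     (\<forall>I \<in> mf_set \<Delta>. dim (mf_cone \<Delta> I) < mf_dim \<Delta> \<longrightarrow> v \<notin> span (mf_cone \<Delta> I))"

definition pre_complete :: "('i, 'a::euclidean_space) multi_fan \<Rightarrow> bool" where
  "pre_complete \<Delta> \<longleftrightarrow> mf_level \<Delta> (mf_dim \<Delta>) \<noteq> {} \<and>
     (\<exists>d. \<forall>v. generic \<Delta> v \<longrightarrow>
        (\<Sum>I \<in> {I \<in> mf_level \<Delta> (mf_dim \<Delta>). v \<in> mf_cone \<Delta> I}. mf_weight \<Delta> I) = d)"

text \<open>The quotient by a subspace \<open>U\<close> is modelled on the orthogonal complement of \<open>U\<close>: the
  quotient map sends a vector to the unique representative of its coset lying there.\<close>

definition quot_map :: "'a::euclidean_space set \<Rightarrow> 'a \<Rightarrow> 'a" where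
  "quot_map U x = (THE y. y \<in> U\<^sup>\<bottom> \<and> x - y \<in> U)"

lemma quot_map_properties:
  assumes "subspace U"
  shows quot_map_linear: "linear (quot_map U)"
    and quot_map_range: "range (quot_map U) = U\<^sup>\<bottom>"
    and quot_map_eq_iff: "quot_map U x = quot_map U y \<longleftrightarrow> x - y \<in> U"
proof -
  have uniq: "y = z" if "y \<in> U\<^sup>\<bottom>" "x - y \<in> U" "z \<in> U\<^sup>\<bottom>" "x - z \<in> U" for x y z
  proof -
    have "y - z \<in> U\<^sup>\<bottom>" by (simp add: subspace_diff subspace_orthogonal_comp that)
    moreover have "y - z \<in> U" using subspace_diff[OF assms that(4) that(2)] by simp
    ultimately show ?thesis by (auto simp: orthogonal_comp_def orthogonal_def)
  qed
  have ex: "\<exists>y. y \<in> U\<^sup>\<bottom> \<and> x - y \<in> U" for x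
  proof -
    obtain y z where "y \<in> span U" "\<And>w. w \<in> span U \<Longrightarrow> orthogonal z w" "x = y + z"
      by (metis orthogonal_subspace_decomp_exists)
    then show ?thesis
      by (intro exI[of _ z]) (auto simp: orthogonal_comp_def orthogonal_commute span_base
          assms subspace_span span_eq_iff[THEN iffD2])
  qed
  have q: "quot_map U x \<in> U\<^sup>\<bottom>" "x - quot_map U x \<in> U" for x
    unfolding quot_map_def using theI'[of "\<lambda>y. y \<in> U\<^sup>\<bottom> \<and> x - y \<in> U"] ex uniq by blast+
  have qI: "quot_map U x = y" if "y \<in> U\<^sup>\<bottom>" "x - y \<in> U" for x y
    using uniq q that by blast
  show "linear (quot_map U)"
  proof (rule linearI)
    show "quot_map U (x + y) = quot_map U x + quot_map U y" for x y
      using subspace_add[OF subspace_orthogonal_comp q(1) q(1)]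
        subspace_add[OF assms q(2)[of x] q(2)[of y]] by (intro qI) (auto simp: algebra_simps)
    show "quot_map U (c *\<^sub>R x) = c *\<^sub>R quot_map U x" for c x
      using subspace_scale[OF subspace_orthogonal_comp q(1)]
        subspace_scale[OF assms q(2)[of x], of c] by (intro qI) (auto simp: algebra_simps)
  qed
  have "quot_map U y = y" if "y \<in> U\<^sup>\<bottom>" for y
    using qI[OF that, of y] subspace_0[OF assms] by simp
  then show "range (quot_map U) = U\<^sup>\<bottom>" using q(1) by (metis image_subset_iff rangeI subsetI subset_antisym)
  show "quot_map U x = quot_map U y \<longleftrightarrow> x - y \<in> U"
  proof
    assume "quot_map U x = quot_map U y"
    then show "x - y \<in> U" using subspace_diff[OF assms q(2)[of x] q(2)[of y]] by simp
  next
    assume "x - y \<in> U"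
    then have "x - quot_map U y \<in> U" using subspace_add[OF assms _ q(2)[of y]] by fastforce
    then show "quot_map U x = quot_map U y" using qI q(1) by blast
  qed
qed

text \<open>The image of the lattice \<open>N\<close> under the quotient map is its quotient by
  \<open>N \<inter> span (mf_cone \<Delta> K)\<close>, which is the subgroup generated by \<open>N \<inter> mf_cone \<Delta> K\<close>.\<close>

definition proj_fan :: "('i, 'a::euclidean_space) multi_fan \<Rightarrow> 'i \<Rightarrow> ('i, 'a) multi_fan" where
  "proj_fan \<Delta> K =
     (let q = quot_map (span (mf_cone \<Delta> K)); \<Sigma>\<^sub>K = {J \<in> mf_set \<Delta>. (K, J) \<in> mf_ord \<Delta>} in
      \<lparr>mf_lattice = q ` mf_lattice \<Delta>,
       mf_set = \<Sigma>\<^sub>K,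
       mf_ord = mf_ord \<Delta> \<inter> \<Sigma>\<^sub>K \<times> \<Sigma>\<^sub>K,
       mf_cone = (\<lambda>J. q ` mf_cone \<Delta> J),
       mf_wpos = mf_wpos \<Delta>,
       mf_wneg = mf_wneg \<Delta>\<rparr>)"

definition complete_fan :: "('i, 'a::euclidean_space) multi_fan \<Rightarrow> bool" where
  "complete_fan \<Delta> \<longleftrightarrow> pre_complete \<Delta> \<and> (\<forall>K \<in> mf_set \<Delta>. pre_complete (proj_fan \<Delta> K))"

definition simplicial_fan :: "('i, 'a::euclidean_space) multi_fan \<Rightarrow> bool" where
  "simplicial_fan \<Delta> \<longleftrightarrow>
     (\<forall>I \<in> mf_set \<Delta>. \<exists>B. independent B \<and> mf_cone \<Delta> I = convex_cone hull B)"

text \<open>The indices \<open>1, \<dots>, d\<close> are represented by the one-dimensional elements of the index poset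
  themselves, and \<open>I\<close>, viewed as a simplex, by its set of vertices.\<close>

abbreviation mf_rays :: "('i, 'a::euclidean_space) multi_fan \<Rightarrow> 'i set" where
  "mf_rays \<Delta> \<equiv> mf_level \<Delta> 1"

definition vertices :: "('i, 'a::euclidean_space) multi_fan \<Rightarrow> 'i \<Rightarrow> 'i set" where
  "vertices \<Delta> I = {i \<in> mf_rays \<Delta>. (i, I) \<in> mf_ord \<Delta>}"


section \<open>Multi-polytopes\<close>

text \<open>The dual of \<open>W = span N\<close> is modelled by the functionals on the ambient space that vanish on
  the orthogonal complement of \<open>W\<close>; restriction to \<open>W\<close> is an isomorphism onto \<open>Hom(W, \<real>)\<close>. For \<open>W\<close>
  the whole space these are all functionals, and for the model \<open>V \<inter> U\<^sup>\<bottom>\<close> of \<open>V / U\<close> they are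
  exactly the elements of the dual of \<open>V\<close> that vanish on \<open>U\<close>.\<close>

definition dual_space :: "'a::euclidean_space set \<Rightarrow> ('a \<Rightarrow>\<^sub>L real) set" where
  "dual_space W = {u. \<forall>x \<in> W\<^sup>\<bottom>. blinfun_apply u x = 0}"

definition affine_hyperplane :: "'b::real_vector set \<Rightarrow> 'b set \<Rightarrow> bool" where
  "affine_hyperplane W H \<longleftrightarrow>
     (\<exists>(g :: 'b \<Rightarrow> real) c. linear g \<and> (\<exists>u \<in> W. g u \<noteq> 0) \<and> H = {u \<in> W. g u = c})"

definition is_multi_polytope ::
    "('i, 'a::euclidean_space) multi_fan \<Rightarrow> ('i \<Rightarrow> ('a \<Rightarrow>\<^sub>L real) set) \<Rightarrow> bool" where
  "is_multi_polytope \<Delta> F \<longleftrightarrow> is_multi_fan \<Delta> \<and> complete_fan \<Delta> \<and>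
     (\<forall>i \<in> mf_rays \<Delta>. affine_hyperplane (dual_space (mf_space \<Delta>)) (F i) \<and>
        (\<forall>x \<in> mf_cone \<Delta> i. \<forall>u \<in> F i. \<forall>u' \<in> F i. blinfun_apply u x = blinfun_apply u' x))"

definition is_simple_multi_polytope ::
    "('i, 'a::euclidean_space) multi_fan \<Rightarrow> ('i \<Rightarrow> ('a \<Rightarrow>\<^sub>L real) set) \<Rightarrow> bool" where
  "is_simple_multi_polytope \<Delta> F \<longleftrightarrow> is_multi_polytope \<Delta> F \<and> simplicial_fan \<Delta>"

definition ray_vectors :: "('i, 'a::euclidean_space) multi_fan \<Rightarrow> ('i \<Rightarrow> 'a) \<Rightarrow> bool" where
  "ray_vectors \<Delta> r \<longleftrightarrow> (\<forall>i \<in> mf_rays \<Delta>. r i \<in> mf_cone \<Delta> i \<and> r i \<noteq> 0)"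


section \<open>The Duistermaat-Heckman function\<close>

text \<open>Below, \<open>r\<close> is the choice of the vectors \<open>v\<^sub>i\<close> and \<open>v\<close> the generic vector.\<close>

definition poly_vertex ::
    "('i, 'a::euclidean_space) multi_fan \<Rightarrow> ('i \<Rightarrow> ('a \<Rightarrow>\<^sub>L real) set) \<Rightarrow> 'i \<Rightarrow> 'a \<Rightarrow>\<^sub>L real" where
  "poly_vertex \<Delta> F I = (THE u. u \<in> dual_space (mf_space \<Delta>) \<and> (\<forall>i \<in> vertices \<Delta> I. u \<in> F i))"

definition dual_vec ::
    "('i, 'a::euclidean_space) multi_fan \<Rightarrow> ('i \<Rightarrow> 'a) \<Rightarrow> 'i \<Rightarrow> 'i \<Rightarrow> 'a \<Rightarrow>\<^sub>L real" where
  "dual_vec \<Delta> r I i = (THE u. u \<in> dual_space (mf_space \<Delta>) \<and>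
     (\<forall>j \<in> vertices \<Delta> I. blinfun_apply u (r j) = (if j = i then 1 else 0)))"

definition dual_vec_pos ::
    "('i, 'a::euclidean_space) multi_fan \<Rightarrow> ('i \<Rightarrow> 'a) \<Rightarrow> 'a \<Rightarrow> 'i \<Rightarrow> 'i \<Rightarrow> 'a \<Rightarrow>\<^sub>L real" where
  "dual_vec_pos \<Delta> r v I i =
     (if blinfun_apply (dual_vec \<Delta> r I i) v > 0 then dual_vec \<Delta> r I i else - dual_vec \<Delta> r I i)"

definition dh_sign :: "('i, 'a::euclidean_space) multi_fan \<Rightarrow> ('i \<Rightarrow> 'a) \<Rightarrow> 'a \<Rightarrow> 'i \<Rightarrow> real" where
  "dh_sign \<Delta> r v I = (- 1) ^ card {i \<in> vertices \<Delta> I. blinfun_apply (dual_vec \<Delta> r I i) v > 0}"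

definition dh_cone ::
    "('i, 'a::euclidean_space) multi_fan \<Rightarrow> ('i \<Rightarrow> ('a \<Rightarrow>\<^sub>L real) set) \<Rightarrow> ('i \<Rightarrow> 'a) \<Rightarrow> 'a \<Rightarrow> 'i
      \<Rightarrow> ('a \<Rightarrow>\<^sub>L real) set" where
  "dh_cone \<Delta> F r v I =
     (\<lambda>x. poly_vertex \<Delta> F I + x) ` (convex_cone hull (dual_vec_pos \<Delta> r v I ` vertices \<Delta> I))"

text \<open>As usual, the values on the hyperplanes \<open>F i\<close> carry no meaning.\<close>

definition DH ::
    "('i, 'a::euclidean_space) multi_fan \<Rightarrow> ('i \<Rightarrow> ('a \<Rightarrow>\<^sub>L real) set) \<Rightarrow> ('i \<Rightarrow> 'a) \<Rightarrow> 'a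
      \<Rightarrow> ('a \<Rightarrow>\<^sub>L real) \<Rightarrow> real" where
  "DH \<Delta> F r v u = (\<Sum>I \<in> mf_level \<Delta> (mf_dim \<Delta>).
     dh_sign \<Delta> r v I * real_of_int (mf_weight \<Delta> I) * indicator (dh_cone \<Delta> F r v I) u)"


section \<open>The multi-polytopes of the facets\<close>

text \<open>A ray of \<open>proj_fan \<Delta> i\<close> is an edge \<open>K = {i, j}\<close> of \<open>\<Delta>\<close>; \<open>other_vertex \<Delta> i K\<close> is \<open>j\<close>.\<close>

definition other_vertex :: "('i, 'a::euclidean_space) multi_fan \<Rightarrow> 'i \<Rightarrow> 'i \<Rightarrow> 'i" where
  "other_vertex \<Delta> i K = (THE j. j \<in> vertices \<Delta> K \<and> j \<noteq> i)"

definition facet_hyperplanes ::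
    "('i, 'a::euclidean_space) multi_fan \<Rightarrow> ('i \<Rightarrow> ('a \<Rightarrow>\<^sub>L real) set) \<Rightarrow> 'i \<Rightarrow> ('a \<Rightarrow>\<^sub>L real)
      \<Rightarrow> 'i \<Rightarrow> ('a \<Rightarrow>\<^sub>L real) set" where
  "facet_hyperplanes \<Delta> F i f K = (\<lambda>u. u - f) ` (F i \<inter> F (other_vertex \<Delta> i K))"

definition facet_rays ::
    "('i, 'a::euclidean_space) multi_fan \<Rightarrow> ('i \<Rightarrow> 'a) \<Rightarrow> 'i \<Rightarrow> 'i \<Rightarrow> 'a" where
  "facet_rays \<Delta> r i K = quot_map (span (mf_cone \<Delta> i)) (r (other_vertex \<Delta> i K))"

definition DH_facet ::
    "('i, 'a::euclidean_space) multi_fan \<Rightarrow> ('i \<Rightarrow> ('a \<Rightarrow>\<^sub>L real) set) \<Rightarrow> ('i \<Rightarrow> 'a) \<Rightarrow> 'a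
      \<Rightarrow> 'i \<Rightarrow> ('a \<Rightarrow>\<^sub>L real) \<Rightarrow> ('a \<Rightarrow>\<^sub>L real) \<Rightarrow> real" where
  "DH_facet \<Delta> F r v i f =
     DH (proj_fan \<Delta> i) (facet_hyperplanes \<Delta> F i f) (facet_rays \<Delta> r i)
        (quot_map (span (mf_cone \<Delta> i)) v)"


section \<open>Crossing a wall\<close>

definition crosses_transversely_at ::
    "'b::real_vector \<Rightarrow> 'b \<Rightarrow> 'b set \<Rightarrow> 'b \<Rightarrow> bool" where
  "crosses_transversely_at a b H m \<longleftrightarrow>
     closed_segment a b \<inter> H = {m} \<and> b - a \<notin> {x - y | x y. x \<in> H \<and> y \<in> H}"

end

theory Submission
  imports Defs
begin

text \<open>Let \<open>F\<^sub>i = {u. \<langle>u, v\<^sub>i\<rangle> = c\<^sub>i}\<close>. In the coordinates dual to \<open>{u\<^sub>i\<^sup>I}\<close> the cone of \<open>I\<close> is an orthant, so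
  \<open>(-1)\<^sup>I \<phi>\<^sub>I(u)\<close> is a product over \<open>i \<in> I\<close> of factors that depend only on the signs of
  \<open>\<langle>u\<^sub>i\<^sup>I, v\<rangle>\<close> and of \<open>\<langle>u, v\<^sub>i\<rangle> - c\<^sub>i\<close>. Crossing \<open>F\<close> changes only the factors with \<open>F\<^sub>i = F\<close>. Each \<open>I\<close>
  has at most one such \<open>i\<close>, its factor jumps by \<open>sign \<langle>u\<^sub>\<beta> - u\<^sub>\<alpha>, v\<^sub>i\<rangle>\<close>, and the remaining factors,
  evaluated at \<open>\<mu>\<close>, form the product belonging to the facet \<open>I - {i}\<close> of the projected fan. Exchanging
  the sums over \<open>I\<close> and \<open>i\<close> gives the formula, simplex by simplex.\<close>

section \<open>Faces of polyhedral cones\<close>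

text \<open>The midpoint of \<open>x\<close> and \<open>y\<close> lies in \<open>F\<close> by
  homogeneity and in the open segment between them, so the defining property of a face applies. For
  \<open>x = y\<close> that segment is empty, and halving \<open>x + y\<close> already gives
  \<open>x\<close>.\<close>

lemma face_of_convex_cone_add:
  assumes "F face_of C" "convex_cone F" "convex_cone C" "x \<in> C" "y \<in> C" "x + y \<in> F"
  shows "x \<in> F"
proof (cases "x = y")
  case True
  then have "x = (1/2) *\<^sub>R (x + y)" by (simp add: scaleR_2 [symmetric])
  then show ?thesis using assms(2,6) by (metis convex_cone_scaleR zero_le_divide_1_iff zero_le_numeral)
next
  case False
  have "(1/2) *\<^sub>R (x + y) \<in> open_segment x y"
    using False by (auto simp: in_segment scaleR_add_right intro!: exI[of _ "1/2"])
  moreover have "(1/2) *\<^sub>R (x + y) \<in> F" using assms(2,6) by (simp add: convex_cone_scaleR)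
  ultimately show ?thesis using face_ofD[OF assms(1)] assms(4,5) by blast
qed

text \<open>A point of \<open>F\<close> is a combination of generators inside \<open>F\<close> plus
  one of generators outside \<open>F\<close>; the face property forces the second part to be
  \<open>0\<close>.\<close>

lemma face_of_convex_cone_hull_eq:
  assumes "F face_of convex_cone hull S" "convex_cone F"
  shows "F = convex_cone hull (S \<inter> F)"
proof
  show "convex_cone hull (S \<inter> F) \<subseteq> F" using assms(2) by (intro hull_minimal) auto
  let ?C = "convex_cone hull S"
  \<comment> \<open>\<open>T\<close> is a convex cone because a sum landing in \<open>F\<close> has
    both summands in \<open>F\<close>. It contains all generators outside \<open>F\<close>, hence
    their hull, and meets \<open>F\<close> only in \<open>0\<close>.\<close>
  define T where "T = {z \<in> ?C. z = 0 \<or> z \<notin> F}"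
  have add: "x \<in> F" if "x \<in> ?C" "y \<in> ?C" "x + y \<in> F" for x y
    using face_of_convex_cone_add[OF assms convex_cone_convex_cone_hull that] .
  have "convex_cone T"
    unfolding convex_cone_iff
  proof (intro conjI ballI allI impI)
    show "0 \<in> T" by (simp add: T_def convex_cone_hull_contains_0)
    show "x + y \<in> T" if "x \<in> T" "y \<in> T" for x y
      using that add[of x y] add[of y x] by (auto simp: T_def convex_cone_hull_add add.commute)
    show "c *\<^sub>R x \<in> T" if "x \<in> T" "0 \<le> c" for x c
    proof (cases "c = 0")
      case False
      have "x \<in> F" if "c *\<^sub>R x \<in> F"
        using convex_cone_scaleR[OF assms(2) _ that, of "1/c"] False \<open>0 \<le> c\<close> by simp
      then show ?thesis using that by (auto simp: T_def convex_cone_hull_mul)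
    qed (simp add: T_def convex_cone_hull_contains_0)
  qed
  then have T: "convex_cone hull (S - F) \<subseteq> T"
    by (intro hull_minimal) (auto simp: T_def hull_inc)
  show "F \<subseteq> convex_cone hull (S \<inter> F)"
  proof
    fix x assume x: "x \<in> F"
    then have "x \<in> convex_cone hull ((S \<inter> F) \<union> (S - F))"
      using face_of_imp_subset[OF assms(1)] by (auto simp: Un_Diff_Int Int_Un_eq Un_commute)
    then obtain y z where yz: "y \<in> convex_cone hull (S \<inter> F)" "z \<in> convex_cone hull (S - F)" "x = y + z"
      by (auto simp: convex_cone_hull_Un)
    have "y \<in> ?C" using yz(1) hull_mono[of "S \<inter> F" S] by blast
    with yz T x add[of z y] have "z = 0" by (auto simp: T_def add.commute)
    with yz show "x \<in> convex_cone hull (S \<inter> F)" by simp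
  qed
qed

text \<open>Prescribed values on an independent set extend to a linear functional \<open>g\<close>,
  and \<open>adjoint g 1\<close> is the vector representing it.\<close>

lemma independent_inner_extend:
  fixes B :: "'a::euclidean_space set"
  assumes "independent B"
  shows "\<exists>a. \<forall>b \<in> B. a \<bullet> b = c b"
proof -
  obtain g :: "'a \<Rightarrow> real" where g: "linear g" "\<And>b. b \<in> B \<Longrightarrow> g b = c b"
    using linear_independent_extend[OF assms] by metis
  have "adjoint g 1 \<bullet> x = g x" for x
    using adjoint_works[OF g(1), of x 1] by (simp add: inner_commute)
  with g(2) show ?thesis by metis
qed

text \<open>A functional that is \<open>0\<close> on \<open>A\<close> and \<open>1\<close> on
  \<open>B - A\<close> is nonnegative on the cone. Its kernel cuts out a face, and the generators
  lying in that face are exactly those in \<open>A\<close>.\<close>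

lemma convex_cone_hull_subset_face_of:
  fixes B :: "'a::euclidean_space set"
  assumes "independent B" "A \<subseteq> B"
  shows "convex_cone hull A face_of convex_cone hull B"
proof -
  obtain a where a: "\<And>b. b \<in> B \<Longrightarrow> a \<bullet> b = (if b \<in> A then 0 else 1)"
    using independent_inner_extend[OF assms(1), of "\<lambda>b. if b \<in> A then 0 else 1"] by metis
  let ?F = "convex_cone hull B \<inter> {x. a \<bullet> x = 0}"
  have "convex_cone hull B \<subseteq> {x. a \<bullet> x \<ge> 0}"
    by (intro hull_minimal convex_cone_halfspace_ge) (auto simp: a)
  then have face: "?F face_of convex_cone hull B"
    by (intro face_of_Int_supporting_hyperplane_ge convex_convex_cone_hull) auto
  have "convex_cone ?F"
    by (auto simp: convex_cone_iff convex_cone_hull_contains_0 convex_cone_hull_add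
        convex_cone_hull_mul inner_simps)
  from face_of_convex_cone_hull_eq[OF face this] have "?F = convex_cone hull (B \<inter> ?F)" .
  moreover have "B \<inter> ?F = A" using a assms(2) by (auto simp: hull_inc split: if_splits)
  ultimately show ?thesis using face by simp
qed

section \<open>Rays, and spans and dimensions of finitely generated cones\<close>

lemma convex_cone_hull_singleton: "convex_cone hull {x} = {t *\<^sub>R x | t. 0 \<le> t}"
proof (rule hull_unique)
  show "{x} \<subseteq> {t *\<^sub>R x |t. 0 \<le> t}" by (auto intro: exI[of _ 1])
  show "convex_cone {t *\<^sub>R x |t. 0 \<le> t}"
    unfolding convex_cone_iff
  proof (intro conjI ballI allI impI; clarify)
    show "\<exists>t. 0 = t *\<^sub>R x \<and> 0 \<le> t" by (intro exI[of _ 0]) simp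
    show "\<exists>t. s *\<^sub>R x + s' *\<^sub>R x = t *\<^sub>R x \<and> 0 \<le> t" if "0 \<le> s" "0 \<le> s'" for s s'
      using that by (intro exI[of _ "s + s'"]) (simp add: scaleR_add_left)
    show "\<exists>t. c *\<^sub>R s *\<^sub>R x = t *\<^sub>R x \<and> 0 \<le> t" if "0 \<le> c" "0 \<le> s" for c s
      using that by (intro exI[of _ "c * s"]) simp
  qed
  show "{t *\<^sub>R x |t. 0 \<le> t} \<subseteq> C" if "{x} \<subseteq> C" "convex_cone C" for C
    using that by (auto intro: convex_cone_scaleR)
qed

text \<open>This makes any nonzero vector of a ray as good a generator as any other, so that an
  arbitrary choice of the \<open>r i\<close> can replace the generators supplied by
  \<open>simplicial_fan\<close>.\<close>

lemma convex_cone_hull_singleton_eq: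
  assumes "y \<in> convex_cone hull {x}" "y \<noteq> 0"
  shows "convex_cone hull {y} = convex_cone hull {x}"
proof
  obtain t where t: "y = t *\<^sub>R x" "t > 0"
    using assms by (auto simp: convex_cone_hull_singleton order_less_le)
  then have "x = (1/t) *\<^sub>R y" by simp
  then have "x \<in> convex_cone hull {y}"
    using t(2) unfolding convex_cone_hull_singleton by (auto intro!: exI[of _ "1/t"])
  then show "convex_cone hull {x} \<subseteq> convex_cone hull {y}"
    by (intro hull_minimal) (auto simp: convex_cone_convex_cone_hull)
  show "convex_cone hull {y} \<subseteq> convex_cone hull {x}"
    using assms by (intro hull_minimal) (auto simp: convex_cone_convex_cone_hull)
qed

lemma span_convex_cone_hull: "span (convex_cone hull S) = span S"
proof
  have "convex_cone hull S \<subseteq> span S"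
    by (intro hull_minimal convex_cone_span span_superset)
  then show "span (convex_cone hull S) \<subseteq> span S" by (simp add: span_minimal)
  show "span S \<subseteq> span (convex_cone hull S)" by (intro span_mono hull_subset)
qed

lemma dim_convex_cone_hull: "dim (convex_cone hull S) = dim S"
  by (metis dim_span span_convex_cone_hull)

lemma dim_convex_cone_hull_independent:
  assumes "independent B"
  shows "dim (convex_cone hull B) = card B"
  by (simp add: assms dim_convex_cone_hull dim_eq_card_independent)

text \<open>A face is generated by the lattice generators it contains, hence is rational, and it
  inherits the absence of lines. This puts faces into the target of the bijection in the third
  multi-fan axiom.\<close>

lemma face_of_in_Cone:
  assumes "C \<in> Cone N" "F face_of C" "convex_cone F"
  shows "F \<in> Cone N"
proof -
  obtain S where S: "finite S" "S \<subseteq> N" "C = convex_cone hull S" using assms(1) by (auto simp: Cone_def)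
  have "F = convex_cone hull (S \<inter> F)"
    using face_of_convex_cone_hull_eq assms(2,3) S(3) by blast
  moreover have "\<nexists>a d. d \<noteq> 0 \<and> range (\<lambda>t::real. a + t *\<^sub>R d) \<subseteq> F"
    using assms(1) face_of_imp_subset[OF assms(2)] unfolding Cone_def by blast
  moreover have "finite (S \<inter> F)" "S \<inter> F \<subseteq> N" using S by auto
  ultimately show ?thesis unfolding Cone_def mem_Collect_eq by metis
qed

section \<open>Simplices of a simplicial multi-fan\<close>

lemma is_multi_fanD:
  assumes "is_multi_fan \<Delta>"
  shows "partial_order_on (mf_set \<Delta>) (mf_ord \<Delta>)" "finite (mf_set \<Delta>)"
    and mf_cone_in_Cone: "I \<in> mf_set \<Delta> \<Longrightarrow> mf_cone \<Delta> I \<in> Cone (mf_lattice \<Delta>)"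
    and mf_cone_bij: "J \<in> mf_set \<Delta> \<Longrightarrow> bij_betw (mf_cone \<Delta>) {I. (I, J) \<in> mf_ord \<Delta>}
      {\<kappa> \<in> Cone (mf_lattice \<Delta>). \<kappa> face_of mf_cone \<Delta> J}"
    and "J \<in> mf_set \<Delta> \<Longrightarrow> (I, J) \<in> mf_ord \<Delta> \<Longrightarrow> (I', J) \<in> mf_ord \<Delta> \<Longrightarrow>
      (I, I') \<in> mf_ord \<Delta> \<longleftrightarrow> mf_cone \<Delta> I face_of mf_cone \<Delta> I'"
proof -
  note fan = assms[unfolded is_multi_fan_def]
  show "partial_order_on (mf_set \<Delta>) (mf_ord \<Delta>)"
    by (insert fan, elim conjE, assumption)
  show "finite (mf_set \<Delta>)"
    by (insert fan, elim conjE, assumption)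
  have "mf_cone \<Delta> ` mf_set \<Delta> \<subseteq> Cone (mf_lattice \<Delta>)"
    by (insert fan, elim conjE, assumption)
  then show "I \<in> mf_set \<Delta> \<Longrightarrow> mf_cone \<Delta> I \<in> Cone (mf_lattice \<Delta>)"
    by (rule image_subset_iff[THEN iffD1, rule_format])
  have faces: "\<forall>J \<in> mf_set \<Delta>.
      bij_betw (mf_cone \<Delta>) {I. (I, J) \<in> mf_ord \<Delta>}
        {\<kappa> \<in> Cone (mf_lattice \<Delta>). \<kappa> face_of mf_cone \<Delta> J} \<and>
      (\<forall>I I'. (I, J) \<in> mf_ord \<Delta> \<and> (I', J) \<in> mf_ord \<Delta> \<longrightarrow>
         ((I, I') \<in> mf_ord \<Delta> \<longleftrightarrow> mf_cone \<Delta> I face_of mf_cone \<Delta> I'))"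
    by (insert fan, elim conjE, assumption)
  show "J \<in> mf_set \<Delta> \<Longrightarrow> bij_betw (mf_cone \<Delta>) {I. (I, J) \<in> mf_ord \<Delta>}
      {\<kappa> \<in> Cone (mf_lattice \<Delta>). \<kappa> face_of mf_cone \<Delta> J}"
    using bspec[OF faces] by (rule conjunct1)
  show "J \<in> mf_set \<Delta> \<Longrightarrow> (I, J) \<in> mf_ord \<Delta> \<Longrightarrow> (I', J) \<in> mf_ord \<Delta> \<Longrightarrow>
      (I, I') \<in> mf_ord \<Delta> \<longleftrightarrow> mf_cone \<Delta> I face_of mf_cone \<Delta> I'"
    using bspec[OF faces, THEN conjunct2, THEN spec, THEN spec, THEN mp, OF _ conjI] .
qed

lemma mf_ord_sub:
  assumes "is_multi_fan \<Delta>" "(I, J) \<in> mf_ord \<Delta>"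
  shows "I \<in> mf_set \<Delta>" "J \<in> mf_set \<Delta>"
  using partial_order_onD(4)[OF is_multi_fanD(1)[OF assms(1)]] assms(2) by auto

lemma mf_ord_trans:
  assumes "is_multi_fan \<Delta>" "(I, J) \<in> mf_ord \<Delta>" "(J, K) \<in> mf_ord \<Delta>"
  shows "(I, K) \<in> mf_ord \<Delta>"
  using transD[OF partial_order_onD(2)[OF is_multi_fanD(1)[OF assms(1)]] assms(2,3)] .

lemma mf_ord_iff:
  assumes "is_multi_fan \<Delta>" "(I, J) \<in> mf_ord \<Delta>" "(I', J) \<in> mf_ord \<Delta>"
  shows "(I, I') \<in> mf_ord \<Delta> \<longleftrightarrow> mf_cone \<Delta> I face_of mf_cone \<Delta> I'"
  using is_multi_fanD(5)[OF assms(1) mf_ord_sub(2)[OF assms(1,2)] assms(2,3)] .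

text \<open>The common upper bound \<open>J\<close> matters: elements of the poset without one may
  share the same cone in a multi-fan.\<close>

lemma mf_cone_inj:
  assumes "is_multi_fan \<Delta>" "(I, J) \<in> mf_ord \<Delta>" "(I', J) \<in> mf_ord \<Delta>"
    and "mf_cone \<Delta> I = mf_cone \<Delta> I'"
  shows "I = I'"
  using inj_onD[OF bij_betw_imp_inj_on[OF mf_cone_bij[OF assms(1) mf_ord_sub(2)[OF assms(1,2)]]]]
    assms(2-4) by simp

lemma mf_cone_face:
  assumes "is_multi_fan \<Delta>" "(I, J) \<in> mf_ord \<Delta>"
  shows "mf_cone \<Delta> I face_of mf_cone \<Delta> J"
  using bij_betw_apply[OF mf_cone_bij[OF assms(1) mf_ord_sub(2)[OF assms]], of I] assms(2) by simp

text \<open>Surjectivity in the third axiom. The assumption \<open>convex_cone \<kappa>\<close>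
  rules out the empty face, which \<open>face_of\<close> admits.\<close>

lemma mf_face_ex:
  assumes "is_multi_fan \<Delta>" "J \<in> mf_set \<Delta>" "\<kappa> face_of mf_cone \<Delta> J" "convex_cone \<kappa>"
  shows "\<exists>I. (I, J) \<in> mf_ord \<Delta> \<and> mf_cone \<Delta> I = \<kappa>"
proof -
  have "\<kappa> \<in> Cone (mf_lattice \<Delta>)"
    using face_of_in_Cone[OF mf_cone_in_Cone[OF assms(1,2)] assms(3,4)] .
  then have "\<kappa> \<in> mf_cone \<Delta> ` {I. (I, J) \<in> mf_ord \<Delta>}"
    using bij_betw_imp_surj_on[OF mf_cone_bij[OF assms(1,2)]] assms(3) by simp
  then show ?thesis by auto
qed

lemma mf_cone_subset_space:
  assumes "is_multi_fan \<Delta>" "I \<in> mf_set \<Delta>"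
  shows "mf_cone \<Delta> I \<subseteq> mf_space \<Delta>"
proof -
  obtain S where "S \<subseteq> mf_lattice \<Delta>" "mf_cone \<Delta> I = convex_cone hull S"
    using mf_cone_in_Cone[OF assms] by (auto simp: Cone_def)
  moreover have "convex_cone hull S \<subseteq> span S"
    by (intro hull_minimal convex_cone_span span_superset)
  ultimately show ?thesis
    unfolding mf_space_def using span_mono by blast
qed

lemma finite_vertices: "is_multi_fan \<Delta> \<Longrightarrow> finite (vertices \<Delta> I)"
  using is_multi_fanD(2)[of \<Delta>] by (simp add: vertices_def mf_level_def)

lemma ray_cone_eq:
  assumes "is_multi_fan \<Delta>" "simplicial_fan \<Delta>" "ray_vectors \<Delta> r" "i \<in> mf_rays \<Delta>"
  shows "mf_cone \<Delta> i = convex_cone hull {r i}"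
proof -
  from assms(4) have "i \<in> mf_set \<Delta>" by (simp add: mf_level_def)
  with assms(2) obtain B where B: "independent B" "mf_cone \<Delta> i = convex_cone hull B"
    unfolding simplicial_fan_def by blast
  then have "card B = 1"
    using assms(4) dim_convex_cone_hull_independent[OF B(1)] by (simp add: mf_level_def)
  then obtain b where "B = {b}" by (auto simp: card_1_singleton_iff)
  moreover have "r i \<in> mf_cone \<Delta> i" "r i \<noteq> 0" using assms(3,4) by (simp_all add: ray_vectors_def)
  ultimately show ?thesis using B(2) convex_cone_hull_singleton_eq by blast
qed

text \<open>The independent generators \<open>B\<close> given by simpliciality are matched with the
  vertices of \<open>J\<close>: each generator spans a one-dimensional face, which the third axiom
  indexes by a vertex, and each vertex ray is spanned by a generator.\<close>

lemma simplex_structure: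
  assumes fan: "is_multi_fan \<Delta>" and simp: "simplicial_fan \<Delta>" and r: "ray_vectors \<Delta> r"
    and J: "J \<in> mf_set \<Delta>"
  shows "inj_on r (vertices \<Delta> J)" and "independent (r ` vertices \<Delta> J)"
    and "mf_cone \<Delta> J = convex_cone hull (r ` vertices \<Delta> J)"
proof -
  obtain B where B: "independent B" "mf_cone \<Delta> J = convex_cone hull B"
    using simp J unfolding simplicial_fan_def by blast
  have finB: "finite B" using B(1) by (rule finiteI_independent)
  let ?V = "vertices \<Delta> J"
  have cone: "mf_cone \<Delta> i = convex_cone hull {r i}" and ord: "(i, J) \<in> mf_ord \<Delta>" if "i \<in> ?V" for i
    using that ray_cone_eq[OF fan simp r] by (auto simp: vertices_def)
  show inj: "inj_on r ?V"
    using cone ord mf_cone_inj[OF fan] by (intro inj_onI) metis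
  \<comment> \<open>The ray is a face, so it is generated by the elements of \<open>B\<close> in it.
    There is at least one, since otherwise the ray would be \<open>{0}\<close> although it contains
    \<open>r i\<close>.\<close>
  have to_B: "\<exists>b \<in> B. convex_cone hull {b} = mf_cone \<Delta> i" if i: "i \<in> ?V" for i
  proof -
    let ?F = "convex_cone hull {r i}"
    have "?F face_of convex_cone hull B"
      using mf_cone_face[OF fan ord[OF i]] cone[OF i] B(2) by simp
    then have "?F = convex_cone hull (B \<inter> ?F)"
      using face_of_convex_cone_hull_eq convex_cone_convex_cone_hull by blast
    moreover have "r i \<in> ?F" "r i \<noteq> 0"
      using r i by (auto simp: hull_inc ray_vectors_def vertices_def)
    moreover have "convex_cone hull {} = {0::'b}" by (intro hull_unique) (auto simp: convex_cone_contains_0)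
    ultimately obtain b where b: "b \<in> B" "b \<in> ?F" by (metis IntD1 IntD2 equals0I singletonD)
    moreover have "b \<noteq> 0" using b(1) B(1) dependent_zero by blast
    ultimately show ?thesis using convex_cone_hull_singleton_eq cone[OF i] by metis
  qed
  have from_B: "\<exists>i \<in> ?V. mf_cone \<Delta> i = convex_cone hull {b}" if b: "b \<in> B" for b
  proof -
    have "convex_cone hull {b} face_of mf_cone \<Delta> J"
      using convex_cone_hull_subset_face_of[OF B(1), of "{b}"] b B(2) by simp
    then obtain i where i: "(i, J) \<in> mf_ord \<Delta>" "mf_cone \<Delta> i = convex_cone hull {b}"
      using mf_face_ex[OF fan J] convex_cone_convex_cone_hull by blast
    have "independent {b}" using B(1) b independent_mono by blast
    then have "dim (mf_cone \<Delta> i) = 1" using dim_convex_cone_hull_independent i(2) by fastforce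
    then show ?thesis using i mf_ord_sub[OF fan i(1)] by (auto simp: vertices_def mf_level_def)
  qed
  show hull: "mf_cone \<Delta> J = convex_cone hull (r ` ?V)"
  proof
    have "b \<in> convex_cone hull (r ` ?V)" if "b \<in> B" for b
    proof -
      obtain i where "i \<in> ?V" "convex_cone hull {r i} = convex_cone hull {b}"
        using from_B[OF \<open>b \<in> B\<close>] cone by metis
      then have "b \<in> convex_cone hull {r i}" "{r i} \<subseteq> r ` ?V" by (auto simp: hull_inc)
      then show ?thesis using hull_mono by blast
    qed
    then show "mf_cone \<Delta> J \<subseteq> convex_cone hull (r ` ?V)"
      unfolding B(2) by (intro hull_minimal convex_cone_convex_cone_hull) auto
    have "r i \<in> mf_cone \<Delta> J" if "i \<in> ?V" for i
      using cone[OF that] mf_cone_face[OF fan ord[OF that]] face_of_imp_subset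
      by (metis hull_inc insertI1 subsetD)
    then show "convex_cone hull (r ` ?V) \<subseteq> mf_cone \<Delta> J"
      unfolding B(2) by (intro hull_minimal convex_cone_convex_cone_hull) auto
  qed
  \<comment> \<open>Matching vertices injectively with generators bounds the number of vectors
    \<open>r i\<close> by \<open>card B\<close>, which is the dimension of their span. A spanning
    set that small is independent.\<close>
  obtain \<beta> where \<beta>: "\<And>i. i \<in> ?V \<Longrightarrow> \<beta> i \<in> B \<and> convex_cone hull {\<beta> i} = mf_cone \<Delta> i"
    using to_B by metis
  have "inj_on \<beta> ?V" by (intro inj_onI) (metis \<beta> ord mf_cone_inj[OF fan])
  then have "card (r ` ?V) \<le> card B"
    using card_inj_on_le[of \<beta> ?V B] \<beta> finB by (auto simp: card_image inj)
  moreover have "dim (r ` ?V) = card B"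
    by (metis B dim_convex_cone_hull dim_convex_cone_hull_independent hull)
  ultimately show "independent (r ` ?V)"
    using card_le_dim_spanning[of "r ` ?V" "r ` ?V"] finite_vertices[OF fan, of J]
    by (auto simp: span_superset)
qed

section \<open>Dual bases and the cones of the vertices\<close>

lemma subspace_dual_space: "subspace (dual_space W)"
  by (auto simp: subspace_def dual_space_def blinfun.bilinear_simps)

text \<open>Both functionals vanish on the orthogonal complement of \<open>span B\<close>, so only
  the component of a vector in \<open>span B\<close> counts.\<close>

lemma dual_space_eqI:
  assumes "u \<in> dual_space (span B)" "u' \<in> dual_space (span B)"
    and "\<And>b. b \<in> B \<Longrightarrow> blinfun_apply u b = blinfun_apply u' b"
  shows "u = u'"
proof (rule blinfun_eqI)
  fix x
  obtain y z where yz: "y \<in> span B" "\<And>w. w \<in> span B \<Longrightarrow> orthogonal z w" "x = y + z"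
    by (metis orthogonal_subspace_decomp_exists)
  then have "z \<in> (span B)\<^sup>\<bottom>" by (simp add: orthogonal_comp_def orthogonal_commute)
  then have "blinfun_apply u z = 0" "blinfun_apply u' z = 0"
    using assms(1,2) by (auto simp: dual_space_def)
  moreover have "blinfun_apply u y = blinfun_apply u' y"
    by (rule linear_eq_on_span[OF _ _ assms(3) yz(1)])
       (simp_all add: blinfun.bounded_linear_right bounded_linear.linear)
  ultimately show "blinfun_apply u x = blinfun_apply u' x"
    by (simp add: yz(3) blinfun.bilinear_simps)
qed

text \<open>The basis is indexed by a family so that the vertices themselves serve as indices; on
  passing to a facet the index set changes from vertices to edges.\<close>

definition basis_family :: "'a::euclidean_space set \<Rightarrow> 'i set \<Rightarrow> ('i \<Rightarrow> 'a) \<Rightarrow> bool" where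
  "basis_family W V r \<longleftrightarrow> inj_on r V \<and> independent (r ` V) \<and> span (r ` V) = W"

lemma basis_family_finite: "basis_family W V r \<Longrightarrow> finite V"
  unfolding basis_family_def by (metis finiteI_independent finite_imageD)

lemma basis_family_eqI:
  assumes "basis_family W V r" "u \<in> dual_space W" "u' \<in> dual_space W"
    and "\<And>j. j \<in> V \<Longrightarrow> blinfun_apply u (r j) = blinfun_apply u' (r j)"
  shows "u = u'"
  using assms dual_space_eqI[of u "r ` V" u'] by (auto simp: basis_family_def)

text \<open>The existence half of duality; together with the uniqueness in
  \<open>basis_family_eqI\<close> it makes the descriptions of \<open>dual_vec\<close> and
  \<open>poly_vertex\<close> well defined.\<close>

lemma basis_family_interpolate:
  assumes "basis_family W V r"
  shows "\<exists>u \<in> dual_space W. \<forall>j \<in> V. blinfun_apply u (r j) = c j"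
proof -
  have r: "inj_on r V" "independent (r ` V)" "span (r ` V) = W"
    using assms by (auto simp: basis_family_def)
  obtain a where a: "\<And>b. b \<in> r ` V \<Longrightarrow> a \<bullet> b = c (inv_into V r b)"
    using independent_inner_extend[OF r(2), of "\<lambda>b. c (inv_into V r b)"] by auto
  \<comment> \<open>Projecting \<open>a\<close> to \<open>W\<close> makes the functional vanish on
    the orthogonal complement and leaves its values on the \<open>r j\<close>, which lie in
    \<open>W\<close>, unchanged.\<close>
  obtain y z where yz: "y \<in> W" "\<And>w. w \<in> W \<Longrightarrow> orthogonal z w" "a = y + z"
    by (metis orthogonal_subspace_decomp_exists r(3))
  have "blinfun_inner_left y \<in> dual_space W"
    using yz(1) by (auto simp: dual_space_def orthogonal_comp_def orthogonal_def inner_commute)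
  moreover have "blinfun_apply (blinfun_inner_left y) (r j) = c j" if "j \<in> V" for j
  proof -
    have "r j \<in> W" using r(3) that span_base[of "r j" "r ` V"] by simp
    then have "z \<bullet> r j = 0" using yz(2) by (simp add: orthogonal_def)
    then show ?thesis using a[of "r j"] that r(1) yz(3) by (simp add: inner_simps inner_commute)
  qed
  ultimately show ?thesis by blast
qed

text \<open>The contribution of a vertex \<open>j\<close> of \<open>I\<close> to \<open>(-1)\<^sup>I \<phi>\<^sub>I(u)\<close>: here \<open>s = \<langle>u\<^sub>j\<^sup>I, v\<rangle>\<close> and
  \<open>t\<close> is the signed distance of \<open>u\<close> from the hyperplane \<open>F\<^sub>j\<close>, measured by \<open>v\<^sub>j\<close>.\<close>

definition wall_factor :: "real \<Rightarrow> real \<Rightarrow> real" where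
  "wall_factor s t = (if s > 0 then (if t \<ge> 0 then - 1 else 0) else (if t \<le> 0 then 1 else 0))"

lemma wall_factor_nonzero: "wall_factor s t \<noteq> 0 \<Longrightarrow> wall_factor s t = (if s > 0 then - 1 else 1)"
  by (auto simp: wall_factor_def split: if_splits)

section \<open>Dual bases, vertices, and the cone of a simplex in dual coordinates\<close>

lemma dual_vec:
  assumes "basis_family (mf_space \<Delta>) (vertices \<Delta> I) r"
  shows dual_vec_in: "dual_vec \<Delta> r I i \<in> dual_space (mf_space \<Delta>)"
    and dual_vec_apply: "j \<in> vertices \<Delta> I \<Longrightarrow>
      blinfun_apply (dual_vec \<Delta> r I i) (r j) = (if j = i then 1 else 0)"
proof -
  let ?P = "\<lambda>u. u \<in> dual_space (mf_space \<Delta>) \<and>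
    (\<forall>j \<in> vertices \<Delta> I. blinfun_apply u (r j) = (if j = i then 1 else 0))"
  obtain u where u: "?P u"
    using basis_family_interpolate[OF assms, of "\<lambda>j. if j = i then 1 else 0"] by blast
  have "dual_vec \<Delta> r I i = u"
    unfolding dual_vec_def
    by (rule the_equality) (use u basis_family_eqI[OF assms] in auto)
  with u show "dual_vec \<Delta> r I i \<in> dual_space (mf_space \<Delta>)"
    "j \<in> vertices \<Delta> I \<Longrightarrow> blinfun_apply (dual_vec \<Delta> r I i) (r j) = (if j = i then 1 else 0)"
    by auto
qed

lemma dual_vec_eqI:
  assumes "basis_family (mf_space \<Delta>) (vertices \<Delta> I) r" "u \<in> dual_space (mf_space \<Delta>)"
    and "\<And>j. j \<in> vertices \<Delta> I \<Longrightarrow> blinfun_apply u (r j) = (if j = i then 1 else 0)"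
  shows "dual_vec \<Delta> r I i = u"
  using basis_family_eqI[OF assms(1) dual_vec_in[OF assms(1)] assms(2)]
    dual_vec_apply[OF assms(1)] assms(3) by simp

lemma poly_vertex:
  assumes bf: "basis_family (mf_space \<Delta>) (vertices \<Delta> I) r"
    and F: "\<And>j. j \<in> vertices \<Delta> I \<Longrightarrow>
      F j = {u \<in> dual_space (mf_space \<Delta>). blinfun_apply u (r j) = c j}"
  shows "poly_vertex \<Delta> F I \<in> dual_space (mf_space \<Delta>)"
    and "j \<in> vertices \<Delta> I \<Longrightarrow> blinfun_apply (poly_vertex \<Delta> F I) (r j) = c j"
proof -
  let ?P = "\<lambda>u. u \<in> dual_space (mf_space \<Delta>) \<and> (\<forall>j \<in> vertices \<Delta> I. blinfun_apply u (r j) = c j)"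
  obtain u where u: "?P u" using basis_family_interpolate[OF bf, of c] by blast
  have "poly_vertex \<Delta> F I = u"
    unfolding poly_vertex_def
    by (rule the_equality) (use u F basis_family_eqI[OF bf] in auto)
  with u show "poly_vertex \<Delta> F I \<in> dual_space (mf_space \<Delta>)"
    "j \<in> vertices \<Delta> I \<Longrightarrow> blinfun_apply (poly_vertex \<Delta> F I) (r j) = c j"
    by auto
qed

text \<open>In the coordinates \<open>blinfun_apply u (r j) - c j\<close>, which are centred at the
  vertex, the cone is an orthant. Nonvanishing of the \<open>j\<close>-th factor is the inequality
  that bounds it in direction \<open>j\<close>.\<close>

lemma mem_dh_cone_iff:
  assumes bf: "basis_family (mf_space \<Delta>) (vertices \<Delta> I) r"
    and F: "\<And>j. j \<in> vertices \<Delta> I \<Longrightarrow>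
      F j = {u \<in> dual_space (mf_space \<Delta>). blinfun_apply u (r j) = c j}"
    and u: "u \<in> dual_space (mf_space \<Delta>)"
  shows "u \<in> dh_cone \<Delta> F r v I \<longleftrightarrow>
    (\<forall>j \<in> vertices \<Delta> I. wall_factor (blinfun_apply (dual_vec \<Delta> r I j) v) (blinfun_apply u (r j) - c j) \<noteq> 0)"
proof -
  let ?V = "vertices \<Delta> I" and ?p = "poly_vertex \<Delta> F I" and ?D = "dual_vec_pos \<Delta> r v I"
  define \<sigma> :: "'b \<Rightarrow> real" where
    "\<sigma> j = (if blinfun_apply (dual_vec \<Delta> r I j) v > 0 then 1 else - 1)" for j
  have D: "?D j = \<sigma> j *\<^sub>R dual_vec \<Delta> r I j" for j
    by (simp add: dual_vec_pos_def \<sigma>_def)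
  have \<sigma>2: "\<sigma> j * \<sigma> j = 1" for j by (simp add: \<sigma>_def)
  have fin: "finite ?V" using bf by (rule basis_family_finite)
  have p: "?p \<in> dual_space (mf_space \<Delta>)" "\<And>j. j \<in> ?V \<Longrightarrow> blinfun_apply ?p (r j) = c j"
    using poly_vertex[OF bf F] by auto
  have mem: "u \<in> dh_cone \<Delta> F r v I \<longleftrightarrow> u - ?p \<in> convex_cone hull (?D ` ?V)"
    unfolding dh_cone_def by (auto simp: image_iff intro!: bexI[of _ "u - ?p"])
  have wf: "wall_factor (blinfun_apply (dual_vec \<Delta> r I j) v) t \<noteq> 0 \<longleftrightarrow> \<sigma> j * t \<ge> 0" for j t
    by (simp add: wall_factor_def \<sigma>_def)
  show ?thesis
    unfolding mem wf
  proof
    \<comment> \<open>The orthant is a convex cone containing the generators, hence contains the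
      cone they generate.\<close>
    let ?H = "{x. \<forall>j \<in> ?V. \<sigma> j * blinfun_apply x (r j) \<ge> 0}"
    have "convex_cone ?H"
      by (auto simp: convex_cone_iff blinfun.bilinear_simps distrib_left mult.left_commute)
    moreover have "?D ` ?V \<subseteq> ?H"
      by (auto simp: D blinfun.bilinear_simps dual_vec_apply[OF bf] \<sigma>2)
    ultimately have "convex_cone hull (?D ` ?V) \<subseteq> ?H" by (intro hull_minimal)
    moreover assume "u - ?p \<in> convex_cone hull (?D ` ?V)"
    ultimately show "\<forall>j \<in> ?V. 0 \<le> \<sigma> j * (blinfun_apply u (r j) - c j)"
      using p(2) by (auto simp: blinfun.bilinear_simps)
  next
    assume *: "\<forall>j \<in> ?V. 0 \<le> \<sigma> j * (blinfun_apply u (r j) - c j)"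
    \<comment> \<open>The expansion of \<open>u - ?p\<close> in the basis \<open>?D\<close>. The
      coefficient carries \<open>\<sigma> j\<close> because \<open>?D j\<close> does too and the two
      signs cancel; by assumption it is nonnegative.\<close>
    define x where "x = (\<Sum>j\<in>?V. (\<sigma> j * (blinfun_apply u (r j) - c j)) *\<^sub>R ?D j)"
    have x_in: "x \<in> dual_space (mf_space \<Delta>)"
      unfolding x_def D by (intro subspace_sum subspace_scale subspace_dual_space dual_vec_in[OF bf])
    have "x = u - ?p"
    proof (rule basis_family_eqI[OF bf x_in])
      show "u - ?p \<in> dual_space (mf_space \<Delta>)" by (intro subspace_diff subspace_dual_space u p)
      fix j assume j: "j \<in> ?V"
      have "blinfun_apply x (r j) = (\<Sum>i\<in>?V. if j = i then (\<sigma> i * \<sigma> i) * (blinfun_apply u (r i) - c i) else 0)"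
        unfolding x_def D using j
        by (auto simp: blinfun.bilinear_simps dual_vec_apply[OF bf] intro!: sum.cong)
      also have "\<dots> = blinfun_apply (u - ?p) (r j)"
        using j fin p(2) by (simp add: \<sigma>2 blinfun.bilinear_simps)
      finally show "blinfun_apply x (r j) = blinfun_apply (u - ?p) (r j)" .
    qed
    moreover have "x \<in> convex_cone hull (?D ` ?V)"
    proof -
      have "(\<Sum>j\<in>S. (\<sigma> j * (blinfun_apply u (r j) - c j)) *\<^sub>R ?D j) \<in> convex_cone hull (?D ` ?V)"
        if "S \<subseteq> ?V" for S
        using finite_subset[OF that fin] that *
        by (induction S rule: finite_induct)
           (auto simp: convex_cone_hull_contains_0 hull_inc intro!: convex_cone_hull_add convex_cone_hull_mul)
      then show ?thesis unfolding x_def by blast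
    qed
    ultimately show "u - ?p \<in> convex_cone hull (?D ` ?V)" by simp
  qed
qed

text \<open>Inside the cone every factor is \<open>- 1\<close> or \<open>1\<close>, and the number
  of factors \<open>- 1\<close> is the exponent in \<open>dh_sign\<close>. Outside it some factor
  vanishes.\<close>

lemma dh_term_eq:
  assumes bf: "basis_family (mf_space \<Delta>) (vertices \<Delta> I) r"
    and F: "\<And>j. j \<in> vertices \<Delta> I \<Longrightarrow>
      F j = {u \<in> dual_space (mf_space \<Delta>). blinfun_apply u (r j) = c j}"
    and u: "u \<in> dual_space (mf_space \<Delta>)"
  shows "dh_sign \<Delta> r v I * indicator (dh_cone \<Delta> F r v I) u =
    (\<Prod>j \<in> vertices \<Delta> I. wall_factor (blinfun_apply (dual_vec \<Delta> r I j) v) (blinfun_apply u (r j) - c j))"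
    (is "_ = (\<Prod>j \<in> ?V. ?w j)")
proof (cases "u \<in> dh_cone \<Delta> F r v I")
  case True
  then have "?w j \<noteq> 0" if "j \<in> ?V" for j using mem_dh_cone_iff[OF bf F u] that by simp
  then have "(\<Prod>j \<in> ?V. ?w j) = (\<Prod>j \<in> ?V. if blinfun_apply (dual_vec \<Delta> r I j) v > 0 then - 1 else 1)"
    by (intro prod.cong refl wall_factor_nonzero)
  also have "\<dots> = dh_sign \<Delta> r v I"
    using basis_family_finite[OF bf] by (simp add: prod.inter_filter [symmetric] dh_sign_def)
  finally show ?thesis using True by simp
next
  case False
  then show ?thesis using mem_dh_cone_iff[OF bf F u] basis_family_finite[OF bf] by (simp add: prod_zero_iff)
qed

lemma basis_family_reindex:
  assumes "basis_family W V r" "bij_betw g V' V" "\<And>k. k \<in> V' \<Longrightarrow> r' k = r (g k)"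
  shows "basis_family W V' r'"
proof -
  have "r' ` V' = r ` V"
    using assms(3) bij_betw_imp_surj_on[OF assms(2)] by force
  moreover have "inj_on r' V' \<longleftrightarrow> inj_on (r \<circ> g) V'"
    using assms(3) by (intro inj_on_cong) simp
  moreover have "inj_on (r \<circ> g) V'"
    using assms(1) bij_betw_imp_inj_on[OF assms(2)] bij_betw_imp_surj_on[OF assms(2)]
    by (intro comp_inj_on) (simp_all add: basis_family_def)
  ultimately show ?thesis using assms(1) by (simp add: basis_family_def)
qed

text \<open>Let \<open>H\<close> be the level set \<open>g = c\<close>. Evaluation at
  \<open>x\<close> is constant on \<open>H\<close>, so it kills the kernel of \<open>g\<close> and
  is a multiple of \<open>g\<close>; as \<open>x \<noteq> 0\<close> the multiple is nonzero, and the
  two equations cut out the same set.\<close>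

lemma affine_hyperplane_dual_space:
  assumes H: "affine_hyperplane (dual_space W) H" and W: "subspace W" "x \<in> W" "x \<noteq> 0"
    and const: "\<And>u u'. u \<in> H \<Longrightarrow> u' \<in> H \<Longrightarrow> blinfun_apply u x = blinfun_apply u' x"
    and f: "f \<in> H"
  shows "H = {u \<in> dual_space W. blinfun_apply u x = blinfun_apply f x}"
proof -
  let ?D = "dual_space W"
  obtain g c where g: "linear g" "H = {u \<in> ?D. g u = c}" "\<exists>u \<in> ?D. g u \<noteq> (0::real)"
    using H unfolding affine_hyperplane_def by blast
  then obtain k1 where k1: "k1 \<in> ?D" "g k1 \<noteq> 0" by blast
  \<comment> \<open>With \<open>g k = 1\<close>, subtracting \<open>g u *\<^sub>R k\<close> moves
    any \<open>u\<close> into the kernel of \<open>g\<close>.\<close>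
  define k where "k = (1 / g k1) *\<^sub>R k1"
  have k: "k \<in> ?D" "g k = 1"
    using k1 g(1) by (simp_all add: k_def subspace_scale[OF subspace_dual_space] linear_scale)
  have fD: "f \<in> ?D" "g f = c" using f g(2) by auto
  have ker: "blinfun_apply w x = 0" if "w \<in> ?D" "g w = 0" for w
  proof -
    have "f + w \<in> H"
      using that fD by (simp add: g(2) subspace_add[OF subspace_dual_space] linear_add[OF g(1)])
    then show ?thesis using const[OF _ f] by (force simp: blinfun.add_left)
  qed
  have k_apply: "blinfun_apply u x = g u * blinfun_apply k x" if "u \<in> ?D" for u
  proof -
    have "u - g u *\<^sub>R k \<in> ?D"
      using that k(1) by (intro subspace_diff subspace_scale subspace_dual_space)
    moreover have "g (u - g u *\<^sub>R k) = 0"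
      using k(2) by (simp add: linear_diff[OF g(1)] linear_scale[OF g(1)])
    ultimately show ?thesis using ker by (force simp: blinfun.diff_left blinfun.scaleR_left)
  qed
  \<comment> \<open>The functional given by the inner product with \<open>x\<close> takes the value
    \<open>x \<bullet> x \<noteq> 0\<close> at \<open>x\<close>, so the multiple cannot be
    zero.\<close>
  have "blinfun_inner_left x \<in> ?D"
    using W(2) by (auto simp: dual_space_def orthogonal_comp_def orthogonal_def inner_commute)
  from k_apply[OF this] have "blinfun_apply k x \<noteq> 0" using W(3) by auto
  then show ?thesis using k_apply fD unfolding g(2) by auto
qed

section \<open>Quotients by a ray\<close>

lemma quot_map_eqI:
  assumes "subspace U" "y \<in> U\<^sup>\<bottom>" "x - y \<in> U"
  shows "quot_map U x = y"
  unfolding quot_map_def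
proof (rule the_equality)
  show "y \<in> U\<^sup>\<bottom> \<and> x - y \<in> U" using assms by simp
  fix z assume z: "z \<in> U\<^sup>\<bottom> \<and> x - z \<in> U"
  then have "z - y \<in> U\<^sup>\<bottom>" using assms(2) by (simp add: subspace_diff subspace_orthogonal_comp)
  moreover have "z - y \<in> U" using subspace_diff[OF assms(1,3) conjunct2[OF z]] by simp
  ultimately show "z = y" by (auto simp: orthogonal_comp_def orthogonal_def)
qed

lemma quot_map_in: "subspace U \<Longrightarrow> quot_map U x \<in> U\<^sup>\<bottom>"
  using quot_map_range[of U] by blast

lemma diff_quot_map_in:
  assumes "subspace U"
  shows "x - quot_map U x \<in> U"
proof -
  obtain y z where yz: "y \<in> span U" "\<And>w. w \<in> span U \<Longrightarrow> orthogonal z w" "x = y + z"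
    by (metis orthogonal_subspace_decomp_exists)
  then have "z \<in> U\<^sup>\<bottom>" by (simp add: orthogonal_comp_def orthogonal_commute span_base)
  moreover have "y \<in> U" using yz(1) span_eq_iff[THEN iffD2, OF assms] by simp
  ultimately show ?thesis using quot_map_eqI[OF assms, of z x] yz(3) by simp
qed

lemma dual_space_quot:
  assumes W: "subspace W" and U: "subspace U" "U \<subseteq> W"
  shows "dual_space (quot_map U ` W) = {u \<in> dual_space W. \<forall>x \<in> U. blinfun_apply u x = 0}"
proof -
  let ?q = "quot_map U"
  have qW: "?q w \<in> W" if "w \<in> W" for w
    using subspace_diff[OF W that subsetD[OF U(2) diff_quot_map_in[OF U(1), of w]]] by simp
  have sub: "W\<^sup>\<bottom> \<subseteq> (?q ` W)\<^sup>\<bottom>" using qW by (intro orthogonal_comp_anti_mono) auto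
  have subU: "U \<subseteq> (?q ` W)\<^sup>\<bottom>"
    using quot_map_in[OF U(1)] by (auto simp: orthogonal_comp_def orthogonal_commute)
  have "blinfun_apply u z = 0"
    if u: "u \<in> dual_space W" "\<forall>x \<in> U. blinfun_apply u x = 0" and z: "z \<in> (?q ` W)\<^sup>\<bottom>" for u z
  proof -
    obtain w z' where wz: "w \<in> W" "\<And>y. y \<in> W \<Longrightarrow> orthogonal z' y" "z = w + z'"
      using orthogonal_subspace_decomp_exists[of W z] span_eq_iff[THEN iffD2, OF W] by metis
    \<comment> \<open>Since \<open>z = w + z'\<close>, these three orthogonalities leave
      \<open>?q w \<bullet> ?q w = 0\<close>, so \<open>w\<close> lies in \<open>U\<close>.\<close>
    have "?q w \<bullet> z = 0" using z wz(1) by (auto simp: orthogonal_comp_def orthogonal_def)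
    moreover have "?q w \<bullet> z' = 0" using wz(2)[OF qW[OF wz(1)]] by (simp add: orthogonal_def inner_commute)
    moreover have "?q w \<bullet> (w - ?q w) = 0"
      using quot_map_in[OF U(1), of w] diff_quot_map_in[OF U(1), of w]
      unfolding orthogonal_comp_def orthogonal_def mem_Collect_eq by (metis inner_commute)
    ultimately have "?q w \<bullet> ?q w = 0" by (simp add: wz(3) inner_simps)
    then have "w \<in> U" using diff_quot_map_in[OF U(1), of w] by simp
    moreover have "z' \<in> W\<^sup>\<bottom>" using wz(2) by (simp add: orthogonal_comp_def orthogonal_commute)
    ultimately show ?thesis using u by (simp add: wz(3) blinfun.add_right dual_space_def)
  qed
  then show ?thesis using sub subU by (auto simp: dual_space_def)
qed

lemma blinfun_apply_quot_map:
  assumes "subspace U" "\<forall>x \<in> U. blinfun_apply u x = 0"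
  shows "blinfun_apply u (quot_map U x) = blinfun_apply u x"
  using assms(2) diff_quot_map_in[OF assms(1), of x] by (auto simp: blinfun.diff_right)

lemma dim_basis_family: "basis_family W V r \<Longrightarrow> dim W = card V"
  unfolding basis_family_def by (metis card_image dim_eq_card_independent dim_span)

text \<open>The span of the other basis vectors is a complement of \<open>span {r i}\<close>. The
  quotient map is therefore injective on it and already maps it onto the whole quotient.\<close>

lemma basis_family_quot:
  assumes bf: "basis_family W V r" and i: "i \<in> V"
  shows "basis_family (quot_map (span {r i}) ` W) (V - {i}) (\<lambda>j. quot_map (span {r i}) (r j))"
proof -
  let ?q = "quot_map (span {r i})" and ?B = "r ` (V - {i})"
  have r: "inj_on r V" "independent (r ` V)" "span (r ` V) = W"
    using bf by (auto simp: basis_family_def)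
  have lin: "linear ?q" by (rule quot_map_linear) simp
  have q_eq: "?q x = ?q y \<longleftrightarrow> x - y \<in> span {r i}" for x y by (rule quot_map_eq_iff) simp
  have B: "?B = r ` V - {r i}" using r(1) i by (auto dest: inj_onD)
  then have rV: "r ` V = insert (r i) ?B" using i by auto
  have ri: "r i \<notin> span ?B" using r(2) i unfolding B dependent_def by blast
  have inj: "inj_on ?q (span ?B)"
  proof (rule inj_onI)
    fix x y assume xy: "x \<in> span ?B" "y \<in> span ?B" "?q x = ?q y"
    then obtain c where c: "x - y = c *\<^sub>R r i" using q_eq by (auto simp: span_singleton)
    have "c *\<^sub>R r i \<in> span ?B" using span_diff[OF xy(1,2)] c by simp
    then have "c = 0" using ri span_scale[of "c *\<^sub>R r i" ?B "inverse c"] by (cases "c = 0") auto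
    with c show "x = y" by simp
  qed
  have ind: "independent ?B" using r(2) B independent_mono[of "r ` V" ?B] by auto
  have "independent (?q ` ?B)"
    by (rule linear_independent_injective_image[OF lin ind inj])
  moreover have "inj_on (\<lambda>j. ?q (r j)) (V - {i})"
    using comp_inj_on[OF inj_on_subset[OF r(1) Diff_subset] inj_on_subset[OF inj span_superset]]
    by (simp add: o_def)
  moreover have "span (?q ` ?B) = ?q ` W"
  proof -
    have "?q x \<in> ?q ` span ?B" if x: "x \<in> W" for x
    proof -
      obtain k where "x - k *\<^sub>R r i \<in> span ?B"
        using x unfolding r(3)[symmetric] rV span_breakdown_eq by blast
      moreover have "?q x = ?q (x - k *\<^sub>R r i)"
        unfolding q_eq by (simp add: span_scale span_base)
      ultimately show ?thesis by blast
    qed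
    moreover have "span ?B \<subseteq> W" unfolding r(3)[symmetric] by (intro span_mono) auto
    ultimately have "?q ` W = ?q ` span ?B" by blast
    then show ?thesis using linear_span_image[OF lin, of ?B] by simp
  qed
  ultimately show ?thesis unfolding basis_family_def by (simp add: image_image)
qed

text \<open>Extend \<open>x\<close> to a basis of \<open>span X\<close>, indexed by itself; the
  preceding lemma leaves one vector fewer. Passing to the span covers cones as well as
  subspaces.\<close>

lemma dim_quot_image:
  assumes "x \<in> span X" "x \<noteq> 0"
  shows "dim X = Suc (dim (quot_map (span {x}) ` X))"
proof -
  let ?q = "quot_map (span {x})"
  obtain B where B: "{x} \<subseteq> B" "B \<subseteq> span X" "independent B" "span X \<subseteq> span B"
    using maximal_independent_subset_extend[of "{x}" "span X"] assms by auto
  have "span B = span X" using B(2,4) span_minimal[OF B(2)] by auto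
  then have bf: "basis_family (span X) B id" using B(3) by (simp add: basis_family_def)
  have lin: "linear ?q" by (rule quot_map_linear) simp
  have "dim (?q ` X) = dim (?q ` span X)"
    by (metis dim_span linear_span_image[OF lin])
  also have "\<dots> = card (B - {x})"
    using dim_basis_family[OF basis_family_quot[OF bf, of x]] B(1) by simp
  finally show ?thesis
    using dim_basis_family[OF bf] B(1) basis_family_finite[OF bf]
    by (metis card_Suc_Diff1 dim_span insert_subset)
qed

section \<open>Facets\<close>

lemma proj_fan_simps:
  "mf_lattice (proj_fan \<Delta> K) = quot_map (span (mf_cone \<Delta> K)) ` mf_lattice \<Delta>"
  "mf_set (proj_fan \<Delta> K) = {J \<in> mf_set \<Delta>. (K, J) \<in> mf_ord \<Delta>}"
  "mf_ord (proj_fan \<Delta> K) =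
    mf_ord \<Delta> \<inter> {J \<in> mf_set \<Delta>. (K, J) \<in> mf_ord \<Delta>} \<times> {J \<in> mf_set \<Delta>. (K, J) \<in> mf_ord \<Delta>}"
  "mf_cone (proj_fan \<Delta> K) J = quot_map (span (mf_cone \<Delta> K)) ` mf_cone \<Delta> J"
  "mf_weight (proj_fan \<Delta> K) J = mf_weight \<Delta> J"
  by (simp_all add: proj_fan_def Let_def mf_weight_def)

lemma mf_space_proj_fan: "mf_space (proj_fan \<Delta> K) = quot_map (span (mf_cone \<Delta> K)) ` mf_space \<Delta>"
  unfolding mf_space_def proj_fan_simps by (intro linear_span_image quot_map_linear) simp

locale simplicial_multi_fan =
  fixes \<Delta> :: "('i, 'a::euclidean_space) multi_fan" and r :: "'i \<Rightarrow> 'a"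
  assumes fan: "is_multi_fan \<Delta>" and simplicial: "simplicial_fan \<Delta>" and rays: "ray_vectors \<Delta> r"
begin

lemmas simplex = simplex_structure[OF fan simplicial rays]

lemma basis_family_cone: "J \<in> mf_set \<Delta> \<Longrightarrow> basis_family (span (mf_cone \<Delta> J)) (vertices \<Delta> J) r"
  using simplex[of J] by (simp add: basis_family_def span_convex_cone_hull)

lemma card_vertices: "J \<in> mf_set \<Delta> \<Longrightarrow> card (vertices \<Delta> J) = dim (mf_cone \<Delta> J)"
  using dim_basis_family[OF basis_family_cone] by simp

lemma basis_family_top:
  assumes "J \<in> mf_level \<Delta> (mf_dim \<Delta>)"
  shows "basis_family (mf_space \<Delta>) (vertices \<Delta> J) r"
proof -
  have J: "J \<in> mf_set \<Delta>" "dim (mf_cone \<Delta> J) = dim (mf_space \<Delta>)"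
    using assms by (auto simp: mf_level_def mf_dim_def)
  have "subspace (mf_space \<Delta>)" by (simp add: mf_space_def)
  then have "span (mf_cone \<Delta> J) = mf_space \<Delta>"
    using subspace_dim_equal[of "span (mf_cone \<Delta> J)" "mf_space \<Delta>"]
      span_minimal[OF mf_cone_subset_space[OF fan J(1)]] J(2) by simp
  then show ?thesis using basis_family_cone[OF J(1)] by simp
qed

lemma vertices_mono: "(K, I) \<in> mf_ord \<Delta> \<Longrightarrow> vertices \<Delta> K \<subseteq> vertices \<Delta> I"
  using mf_ord_trans[OF fan] by (auto simp: vertices_def)

lemma vertices_inj:
  assumes "(K, I) \<in> mf_ord \<Delta>" "(K', I) \<in> mf_ord \<Delta>" "vertices \<Delta> K = vertices \<Delta> K'"
  shows "K = K'"
  using mf_cone_inj[OF fan assms(1,2)] simplex(3) mf_ord_sub[OF fan] assms by simp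

text \<open>The vectors \<open>r a\<close> with \<open>a \<in> A\<close> generate a face of the cone
  of \<open>I\<close>, hence come from some \<open>K\<close> below \<open>I\<close>. The order
  isomorphism below \<open>I\<close> makes all of \<open>A\<close> vertices of \<open>K\<close>, and
  the dimension leaves room for no others.\<close>

lemma ex_face:
  assumes I: "I \<in> mf_set \<Delta>" and A: "A \<subseteq> vertices \<Delta> I"
  shows "\<exists>K. (K, I) \<in> mf_ord \<Delta> \<and> vertices \<Delta> K = A"
proof -
  have ind: "independent (r ` A)"
    using simplex(2)[OF I] A by (meson image_mono independent_mono)
  have "convex_cone hull (r ` A) face_of mf_cone \<Delta> I"
    using convex_cone_hull_subset_face_of[OF simplex(2)[OF I]] simplex(3)[OF I] A
    by (simp add: image_mono)
  then obtain K where K: "(K, I) \<in> mf_ord \<Delta>" "mf_cone \<Delta> K = convex_cone hull (r ` A)"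
    using mf_face_ex[OF fan I] convex_cone_convex_cone_hull by blast
  have "A \<subseteq> vertices \<Delta> K"
  proof
    fix a assume a: "a \<in> A"
    then have a': "a \<in> mf_rays \<Delta>" "(a, I) \<in> mf_ord \<Delta>" using A by (auto simp: vertices_def)
    have "mf_cone \<Delta> a face_of mf_cone \<Delta> K"
      using convex_cone_hull_subset_face_of[OF ind, of "{r a}"] a K(2)
        ray_cone_eq[OF fan simplicial rays a'(1)] by simp
    then show "a \<in> vertices \<Delta> K"
      using mf_ord_iff[OF fan a'(2) K(1)] a'(1) by (simp add: vertices_def)
  qed
  moreover have "card (vertices \<Delta> K) = card A"
  proof -
    have "card (vertices \<Delta> K) = card (r ` A)"
      using card_vertices[OF mf_ord_sub(1)[OF fan K(1)]] K(2) dim_convex_cone_hull_independent[OF ind]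
      by simp
    then show ?thesis using card_image[OF inj_on_subset[OF simplex(1)[OF I] A]] by simp
  qed
  ultimately have "A = vertices \<Delta> K" using card_subset_eq[OF finite_vertices[OF fan]] by metis
  then show ?thesis using K(1) by blast
qed

lemma span_ray:
  assumes "i \<in> mf_rays \<Delta>"
  shows "span (mf_cone \<Delta> i) = span {r i}"
  using ray_cone_eq[OF fan simplicial rays assms] by (simp add: span_convex_cone_hull)

lemma ray_in_space:
  assumes "i \<in> mf_rays \<Delta>"
  shows "r i \<in> mf_space \<Delta>" "r i \<noteq> 0"
proof -
  have "i \<in> mf_set \<Delta>" using assms by (simp add: mf_level_def)
  then show "r i \<in> mf_space \<Delta>" "r i \<noteq> 0"
    using assms rays mf_cone_subset_space[OF fan] by (auto simp: ray_vectors_def)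
qed

lemma dim_proj_cone:
  assumes "i \<in> vertices \<Delta> J"
  shows "dim (mf_cone \<Delta> J) = Suc (dim (mf_cone (proj_fan \<Delta> i) J))"
proof -
  have i: "i \<in> mf_rays \<Delta>" "(i, J) \<in> mf_ord \<Delta>" using assms by (auto simp: vertices_def)
  have "r i \<in> mf_cone \<Delta> J"
    using simplex(3)[OF mf_ord_sub(2)[OF fan i(2)]] assms by (simp add: hull_inc)
  then show ?thesis
    using dim_quot_image[of "r i" "mf_cone \<Delta> J"] ray_in_space(2)[OF i(1)]
    by (simp add: proj_fan_simps span_ray[OF i(1)] span_base)
qed

lemma dim_proj_fan:
  assumes "i \<in> mf_rays \<Delta>"
  shows "mf_dim \<Delta> = Suc (mf_dim (proj_fan \<Delta> i))"
  using dim_quot_image[of "r i" "mf_space \<Delta>"] ray_in_space[OF assms]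
  by (simp add: mf_dim_def mf_space_proj_fan span_ray[OF assms] span_base)

text \<open>Dividing by the ray lowers the dimension of the space and of each cone through
  \<open>i\<close> by one, so being top-dimensional means the same before and after.\<close>

lemma top_level_proj_fan:
  assumes "i \<in> mf_rays \<Delta>"
  shows "mf_level (proj_fan \<Delta> i) (mf_dim (proj_fan \<Delta> i)) =
    {I \<in> mf_level \<Delta> (mf_dim \<Delta>). i \<in> vertices \<Delta> I}"
proof -
  have "dim (mf_cone (proj_fan \<Delta> i) I) = mf_dim (proj_fan \<Delta> i) \<longleftrightarrow> dim (mf_cone \<Delta> I) = mf_dim \<Delta>"
    if "i \<in> vertices \<Delta> I" for I
    using dim_proj_cone[OF that] dim_proj_fan[OF assms] by simp
  then show ?thesis
    using assms unfolding mf_level_def[of "proj_fan \<Delta> i"] mf_level_def[of \<Delta> "mf_dim \<Delta>"]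
    by (auto simp: proj_fan_simps(2) vertices_def)
qed

text \<open>By the same drop in dimension, a ray of the projected fan is a two-dimensional cone
  through \<open>i\<close>, that is, an edge.\<close>

lemma vertices_proj_fan:
  assumes "i \<in> vertices \<Delta> I"
  shows "vertices (proj_fan \<Delta> i) I =
    {K. (i, K) \<in> mf_ord \<Delta> \<and> (K, I) \<in> mf_ord \<Delta> \<and> card (vertices \<Delta> K) = 2}"
proof -
  have i: "i \<in> mf_rays \<Delta>" "(i, I) \<in> mf_ord \<Delta>" using assms by (auto simp: vertices_def)
  have "dim (mf_cone (proj_fan \<Delta> i) K) = 1 \<longleftrightarrow> card (vertices \<Delta> K) = 2"
    if "(i, K) \<in> mf_ord \<Delta>" for K
    using dim_proj_cone[of i K] card_vertices[OF mf_ord_sub(2)[OF fan that]] that i(1)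
    by (simp add: vertices_def)
  then show ?thesis
    using i(2) mf_ord_sub[OF fan] unfolding vertices_def[of "proj_fan \<Delta> i"] mf_level_def
    by (auto simp: proj_fan_simps(2,3))
qed

lemma other_vertex:
  assumes "i \<in> mf_rays \<Delta>" "(i, K) \<in> mf_ord \<Delta>" "card (vertices \<Delta> K) = 2"
  shows "vertices \<Delta> K = {i, other_vertex \<Delta> i K}" "other_vertex \<Delta> i K \<noteq> i"
proof -
  have "i \<in> vertices \<Delta> K" using assms by (simp add: vertices_def)
  moreover from this have "card (vertices \<Delta> K - {i}) = 1" using assms(3) by simp
  then obtain j where "vertices \<Delta> K - {i} = {j}" by (auto simp: card_1_singleton_iff)
  ultimately have j: "vertices \<Delta> K = {i, j}" "j \<noteq> i" by auto
  then have "other_vertex \<Delta> i K = j" unfolding other_vertex_def by (intro the_equality) auto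
  with j show "vertices \<Delta> K = {i, other_vertex \<Delta> i K}" "other_vertex \<Delta> i K \<noteq> i" by auto
qed

text \<open>This realises the identification of \<open>I\<close>, as a simplex of the projected fan,
  with \<open>I\<close> minus \<open>i\<close>. Edges below \<open>I\<close> are determined by their
  two vertices, and \<open>ex_face\<close> supplies the edge from \<open>i\<close> to any other
  vertex.\<close>

lemma bij_betw_other_vertex:
  assumes "i \<in> vertices \<Delta> I"
  shows "bij_betw (other_vertex \<Delta> i) (vertices (proj_fan \<Delta> i) I) (vertices \<Delta> I - {i})"
proof -
  have i: "i \<in> mf_rays \<Delta>" "(i, I) \<in> mf_ord \<Delta>" using assms by (auto simp: vertices_def)
  show ?thesis
    unfolding vertices_proj_fan[OF assms]
  proof (rule bij_betw_imageI)
    let ?E = "{K. (i, K) \<in> mf_ord \<Delta> \<and> (K, I) \<in> mf_ord \<Delta> \<and> card (vertices \<Delta> K) = 2}"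
    have ov: "vertices \<Delta> K = {i, other_vertex \<Delta> i K}" "other_vertex \<Delta> i K \<noteq> i" "(K, I) \<in> mf_ord \<Delta>"
      if "K \<in> ?E" for K
      using other_vertex[OF i(1), of K] that by simp_all
    show "inj_on (other_vertex \<Delta> i) ?E"
    proof (rule inj_onI)
      fix K K' assume K: "K \<in> ?E" "K' \<in> ?E" "other_vertex \<Delta> i K = other_vertex \<Delta> i K'"
      have "vertices \<Delta> K = vertices \<Delta> K'"
        using ov(1)[OF K(1)] ov(1)[OF K(2)] unfolding K(3) by (rule trans[OF _ sym])
      then show "K = K'" by (rule vertices_inj[OF ov(3)[OF K(1)] ov(3)[OF K(2)]])
    qed
    show "other_vertex \<Delta> i ` ?E = vertices \<Delta> I - {i}"
    proof
      show "other_vertex \<Delta> i ` ?E \<subseteq> vertices \<Delta> I - {i}"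
      proof
        fix j assume "j \<in> other_vertex \<Delta> i ` ?E"
        then obtain K where K: "K \<in> ?E" "j = other_vertex \<Delta> i K" by blast
        then show "j \<in> vertices \<Delta> I - {i}"
          using ov(1,2)[OF K(1)] vertices_mono[OF ov(3)[OF K(1)]] by simp
      qed
      show "vertices \<Delta> I - {i} \<subseteq> other_vertex \<Delta> i ` ?E"
      proof
        fix j assume j: "j \<in> vertices \<Delta> I - {i}"
        then obtain K where K: "(K, I) \<in> mf_ord \<Delta>" "vertices \<Delta> K = {i, j}"
          using ex_face[OF mf_ord_sub(2)[OF fan i(2)], of "{i, j}"] assms by auto
        have iK: "(i, K) \<in> mf_ord \<Delta>" using K(2) by (auto simp: vertices_def)
        have "card (vertices \<Delta> K) = 2" using K(2) j by (auto simp: card_2_iff)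
        then have E: "K \<in> ?E" using K(1) iK by simp
        then have "other_vertex \<Delta> i K = j" using ov(1,2)[OF E] K(2) by (auto simp: doubleton_eq_iff)
        then show "j \<in> other_vertex \<Delta> i ` ?E" using E by blast
      qed
    qed
  qed
qed

section \<open>Dual bases and the Duistermaat-Heckman function of a facet\<close>

lemma dual_space_proj_fan:
  assumes "i \<in> mf_rays \<Delta>"
  shows "dual_space (mf_space (proj_fan \<Delta> i)) = {u \<in> dual_space (mf_space \<Delta>). blinfun_apply u (r i) = 0}"
proof -
  have "span {r i} \<subseteq> mf_space \<Delta>"
    using ray_in_space(1)[OF assms] by (intro span_minimal) (auto simp: mf_space_def)
  moreover have "(\<forall>x \<in> span {r i}. blinfun_apply u x = 0) \<longleftrightarrow> blinfun_apply u (r i) = 0"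
    for u :: "'a \<Rightarrow>\<^sub>L real"
    by (auto simp: span_singleton blinfun.scaleR_right intro: bspec[of _ _ "1 *\<^sub>R r i"])
  ultimately show ?thesis
    unfolding mf_space_proj_fan span_ray[OF assms]
    using dual_space_quot[of "mf_space \<Delta>" "span {r i}"] by (simp add: mf_space_def)
qed

lemma apply_facet_quot:
  assumes "i \<in> mf_rays \<Delta>" "blinfun_apply u (r i) = 0"
  shows "blinfun_apply u (quot_map (span (mf_cone \<Delta> i)) x) = blinfun_apply u x"
proof -
  have "\<forall>y \<in> span {r i}. blinfun_apply u y = 0"
    using assms(2) by (auto simp: span_singleton blinfun.scaleR_right)
  from blinfun_apply_quot_map[OF subspace_span this] show ?thesis by (simp only: span_ray[OF assms(1)])
qed

lemma basis_family_facet: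
  assumes I: "I \<in> mf_level \<Delta> (mf_dim \<Delta>)" and i: "i \<in> vertices \<Delta> I"
  shows "basis_family (mf_space (proj_fan \<Delta> i)) (vertices (proj_fan \<Delta> i) I) (facet_rays \<Delta> r i)"
proof -
  have "i \<in> mf_rays \<Delta>" using i by (simp add: vertices_def)
  then show ?thesis
    using basis_family_reindex[OF basis_family_quot[OF basis_family_top[OF I] i] bij_betw_other_vertex[OF i]]
    by (simp add: facet_rays_def mf_space_proj_fan span_ray)
qed

text \<open>A dual vector belonging to a vertex other than \<open>i\<close> vanishes on
  \<open>r i\<close>. It thus descends to the quotient and satisfies the defining equations
  there.\<close>

lemma dual_vec_facet:
  assumes I: "I \<in> mf_level \<Delta> (mf_dim \<Delta>)" and i: "i \<in> vertices \<Delta> I"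
    and K: "K \<in> vertices (proj_fan \<Delta> i) I"
  shows "dual_vec (proj_fan \<Delta> i) (facet_rays \<Delta> r i) I K = dual_vec \<Delta> r I (other_vertex \<Delta> i K)"
proof -
  note bij = bij_betw_other_vertex[OF i] and bf = basis_family_top[OF I]
  let ?o = "other_vertex \<Delta> i"
  have ray: "i \<in> mf_rays \<Delta>" using i by (simp add: vertices_def)
  have ov: "?o J \<in> vertices \<Delta> I" "?o J \<noteq> i" if "J \<in> vertices (proj_fan \<Delta> i) I" for J
    using bij_betw_apply[OF bij that] by auto
  have 0: "blinfun_apply (dual_vec \<Delta> r I (?o K)) (r i) = 0"
    using dual_vec_apply[OF bf i] ov(2)[OF K] by auto
  show ?thesis
  proof (rule dual_vec_eqI[OF basis_family_facet[OF I i]])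
    show "dual_vec \<Delta> r I (?o K) \<in> dual_space (mf_space (proj_fan \<Delta> i))"
      using dual_vec_in[OF bf] 0 by (simp add: dual_space_proj_fan[OF ray])
    fix J assume J: "J \<in> vertices (proj_fan \<Delta> i) I"
    have "?o J = ?o K \<longleftrightarrow> J = K"
      using inj_on_eq_iff[OF bij_betw_imp_inj_on[OF bij] J K] .
    then show "blinfun_apply (dual_vec \<Delta> r I (?o K)) (facet_rays \<Delta> r i J) = (if J = K then 1 else 0)"
      using dual_vec_apply[OF bf ov(1)[OF J]] by (simp add: facet_rays_def apply_facet_quot[OF ray 0])
  qed
qed

text \<open>Translation by \<open>- f\<close> moves the point and the facet hyperplanes alike, so
  signed distances can be measured in the original space. The facet term is then the original
  product without the factor of \<open>i\<close>.\<close>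

lemma DH_facet_eq:
  assumes F: "\<And>j. j \<in> mf_rays \<Delta> \<Longrightarrow>
      F j = {u \<in> dual_space (mf_space \<Delta>). blinfun_apply u (r j) = c j}"
    and i: "i \<in> mf_rays \<Delta>" and f: "f \<in> F i" and u: "u \<in> F i"
  shows "DH_facet \<Delta> F r v i f (u - f) =
    (\<Sum>I \<in> {I \<in> mf_level \<Delta> (mf_dim \<Delta>). i \<in> vertices \<Delta> I}. real_of_int (mf_weight \<Delta> I) *
      (\<Prod>j \<in> vertices \<Delta> I - {i}.
        wall_factor (blinfun_apply (dual_vec \<Delta> r I j) v) (blinfun_apply u (r j) - c j)))"
  unfolding DH_facet_def DH_def top_level_proj_fan[OF i] proj_fan_simps(5)
proof (rule sum.cong[OF refl])
  fix I assume "I \<in> {I \<in> mf_level \<Delta> (mf_dim \<Delta>). i \<in> vertices \<Delta> I}"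
  then have I: "I \<in> mf_level \<Delta> (mf_dim \<Delta>)" and iI: "i \<in> vertices \<Delta> I" by auto
  note bij = bij_betw_other_vertex[OF iI] and bf = basis_family_facet[OF I iI]
  let ?\<Delta> = "proj_fan \<Delta> i" and ?F = "facet_hyperplanes \<Delta> F i f" and ?r = "facet_rays \<Delta> r i"
    and ?v = "quot_map (span (mf_cone \<Delta> i)) v" and ?o = "other_vertex \<Delta> i"
  have ov: "?o K \<in> vertices \<Delta> I" "?o K \<noteq> i" "?o K \<in> mf_rays \<Delta>" if "K \<in> vertices ?\<Delta> I" for K
    using bij_betw_apply[OF bij that] by (auto simp: vertices_def)
  have fi: "f \<in> dual_space (mf_space \<Delta>)" "blinfun_apply f (r i) = c i"
    and ui: "u \<in> dual_space (mf_space \<Delta>)" "blinfun_apply u (r i) = c i"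
    using f u F[OF i] by auto
  have uf: "u - f \<in> dual_space (mf_space ?\<Delta>)"
    using fi ui by (simp add: dual_space_proj_fan[OF i] subspace_diff[OF subspace_dual_space] blinfun.diff_left)
  have app: "blinfun_apply w (?r K) = blinfun_apply w (r (?o K))"
    if "w \<in> dual_space (mf_space ?\<Delta>)" for w K
  proof -
    have "blinfun_apply w (r i) = 0" using that by (simp add: dual_space_proj_fan[OF i])
    from apply_facet_quot[OF i this] show ?thesis by (simp add: facet_rays_def)
  qed
  \<comment> \<open>Translation by \<open>- f\<close> lowers the constant of \<open>F (?o K)\<close>
    by the value of \<open>f\<close>; the condition of lying on \<open>F i\<close> becomes
    membership in the dual of the quotient.\<close>
  have hyp: "?F K = {w \<in> dual_space (mf_space ?\<Delta>).
      blinfun_apply w (?r K) = c (?o K) - blinfun_apply f (r (?o K))}" (is "_ = ?R")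
    if K: "K \<in> vertices ?\<Delta> I" for K
  proof
    show "?F K \<subseteq> ?R"
    proof
      fix w assume "w \<in> ?F K"
      then obtain x where x: "w = x - f" "x \<in> F i" "x \<in> F (?o K)" by (auto simp: facet_hyperplanes_def)
      then have w: "w \<in> dual_space (mf_space ?\<Delta>)"
        using fi F[OF i]
        by (simp add: dual_space_proj_fan[OF i] subspace_diff[OF subspace_dual_space] blinfun.diff_left)
      show "w \<in> ?R"
        unfolding mem_Collect_eq app[OF w] using w x F[OF ov(3)[OF K]] by (simp add: blinfun.diff_left)
    qed
    show "?R \<subseteq> ?F K"
    proof
      fix w assume w: "w \<in> ?R"
      then have "w \<in> dual_space (mf_space \<Delta>)" "blinfun_apply w (r i) = 0"
        "blinfun_apply w (r (?o K)) = c (?o K) - blinfun_apply f (r (?o K))"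
        using app by (auto simp: dual_space_proj_fan[OF i])
      then have "w + f \<in> F i \<inter> F (?o K)"
        using fi F[OF i] F[OF ov(3)[OF K]]
        by (simp add: subspace_add[OF subspace_dual_space] blinfun.add_left)
      then show "w \<in> ?F K" unfolding facet_hyperplanes_def by (auto intro!: image_eqI[of _ _ "w + f"])
    qed
  qed
  have "dh_sign ?\<Delta> ?r ?v I * indicator (dh_cone ?\<Delta> ?F ?r ?v I) (u - f) =
      (\<Prod>K \<in> vertices ?\<Delta> I. wall_factor (blinfun_apply (dual_vec ?\<Delta> ?r I K) ?v)
        (blinfun_apply (u - f) (?r K) - (c (?o K) - blinfun_apply f (r (?o K)))))"
    by (rule dh_term_eq[OF bf hyp uf])
  \<comment> \<open>The values of \<open>f\<close> cancel, and the quotient map may be dropped from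
    \<open>v\<close> because these dual vectors vanish on \<open>r i\<close>.\<close>
  also have "\<dots> = (\<Prod>K \<in> vertices ?\<Delta> I.
      wall_factor (blinfun_apply (dual_vec \<Delta> r I (?o K)) v) (blinfun_apply u (r (?o K)) - c (?o K)))"
  proof (rule prod.cong[OF refl])
    fix K assume K: "K \<in> vertices ?\<Delta> I"
    have "blinfun_apply (dual_vec \<Delta> r I (?o K)) (r i) = 0"
      using dual_vec_apply[OF basis_family_top[OF I] iI] ov(2)[OF K] by auto
    then show "wall_factor (blinfun_apply (dual_vec ?\<Delta> ?r I K) ?v)
        (blinfun_apply (u - f) (?r K) - (c (?o K) - blinfun_apply f (r (?o K)))) =
        wall_factor (blinfun_apply (dual_vec \<Delta> r I (?o K)) v) (blinfun_apply u (r (?o K)) - c (?o K))"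
      unfolding app[OF uf] dual_vec_facet[OF I iI K]
      by (simp add: apply_facet_quot[OF i] blinfun.diff_left)
  qed
  also have "\<dots> = (\<Prod>j \<in> vertices \<Delta> I - {i}.
      wall_factor (blinfun_apply (dual_vec \<Delta> r I j) v) (blinfun_apply u (r j) - c j))"
    by (rule prod.reindex_bij_betw[OF bij])
  finally show "dh_sign ?\<Delta> ?r ?v I * real_of_int (mf_weight \<Delta> I) *
      indicator (dh_cone ?\<Delta> ?F ?r ?v I) (u - f) = real_of_int (mf_weight \<Delta> I) *
      (\<Prod>j \<in> vertices \<Delta> I - {i}.
        wall_factor (blinfun_apply (dual_vec \<Delta> r I j) v) (blinfun_apply u (r j) - c j))"
    by (simp add: mult_ac)
qed

end

section \<open>Crossing a wall\<close>

lemma wall_factor_cong: "sgn t = sgn t' \<Longrightarrow> wall_factor s t = wall_factor s t'"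
  by (auto simp: wall_factor_def sgn_if split: if_splits)

text \<open>For \<open>a < 0 < b\<close> the factor goes from \<open>0\<close> to \<open>- 1\<close>
  if \<open>s > 0\<close> and from \<open>1\<close> to \<open>0\<close> otherwise: it drops by
  \<open>1\<close> whatever \<open>s\<close> is. The other direction is the reverse.\<close>

lemma wall_factor_jump:
  assumes "a * b < 0"
  shows "wall_factor s a - wall_factor s b = sgn (b - a)"
  using assms by (auto simp: wall_factor_def mult_less_0_iff)

text \<open>\<open>P\<close> marks the crossed walls and \<open>m\<close> holds the distances at the
  crossing point. The right side has at most one summand; it is written as a sum so that it can
  later be exchanged with the sum over simplices.\<close>

lemma wall_factor_prod_jump:
  assumes V: "finite V" and unique: "card {i \<in> V. P i} \<le> 1"
    and jump: "\<And>i. i \<in> V \<Longrightarrow> P i \<Longrightarrow> a i * b i < 0"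
    and same: "\<And>i. i \<in> V \<Longrightarrow> \<not> P i \<Longrightarrow> sgn (a i) = sgn (m i) \<and> sgn (b i) = sgn (m i)"
  shows "(\<Prod>i\<in>V. wall_factor (s i) (a i)) - (\<Prod>i\<in>V. wall_factor (s i) (b i)) =
    (\<Sum>i \<in> {i \<in> V. P i}. sgn (b i - a i) * (\<Prod>j \<in> V - {i}. wall_factor (s j) (m j)))"
proof (cases "{i \<in> V. P i} = {}")
  case True
  then have "wall_factor (s i) (a i) = wall_factor (s i) (b i)" if "i \<in> V" for i
    using same[OF that] that by (intro wall_factor_cong) auto
  then have "(\<Prod>i\<in>V. wall_factor (s i) (a i)) = (\<Prod>i\<in>V. wall_factor (s i) (b i))" by simp
  then show ?thesis unfolding True by simp
next
  case False
  then have "card {i \<in> V. P i} > 0" using V by (intro card_gt_0_iff[THEN iffD2] conjI) auto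
  with unique have "card {i \<in> V. P i} = 1" by linarith
  then obtain i where i: "{i \<in> V. P i} = {i}" by (auto simp: card_1_singleton_iff)
  then have iV: "i \<in> V" "P i" by auto
  let ?R = "\<Prod>j \<in> V - {i}. wall_factor (s j) (m j)"
  have eq: "wall_factor (s j) (a j) = wall_factor (s j) (m j)"
    "wall_factor (s j) (b j) = wall_factor (s j) (m j)" if "j \<in> V - {i}" for j
    using same[of j] that i by (auto intro!: wall_factor_cong)
  have "(\<Prod>i\<in>V. wall_factor (s i) (a i)) = wall_factor (s i) (a i) * ?R"
    "(\<Prod>i\<in>V. wall_factor (s i) (b i)) = wall_factor (s i) (b i) * ?R"
    using eq by (simp_all add: prod.remove[OF V iV(1)])
  then show ?thesis
    using wall_factor_jump[OF jump[OF iV]] unfolding i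
    by (simp add: left_diff_distrib [symmetric])
qed

lemma sgn_no_zero_between:
  fixes a b :: real
  assumes "\<And>t. 0 \<le> t \<Longrightarrow> t \<le> 1 \<Longrightarrow> (1 - t) * a + t * b \<noteq> 0" and "0 \<le> t" "t \<le> 1"
  shows "sgn a = sgn ((1 - t) * a + t * b)"
proof -
  have "a * b > 0"
  proof (rule ccontr)
    assume "\<not> a * b > 0"
    moreover have "a \<noteq> 0" "b \<noteq> 0" using assms(1)[of 0] assms(1)[of 1] by auto
    ultimately have "a > 0 \<and> b < 0 \<or> a < 0 \<and> b > 0" by (auto simp: zero_less_mult_iff)
    \<comment> \<open>With opposite signs at the ends, the affine function has its zero at the
      parameter \<open>a / (a - b)\<close>, inside the unit interval.\<close>
    then have "0 \<le> a / (a - b)" "a / (a - b) \<le> 1" "(1 - a / (a - b)) * a + a / (a - b) * b = 0"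
      by (auto simp: field_simps)
    then show False using assms(1) by blast
  qed
  then consider "a > 0" "b > 0" | "a < 0" "b < 0" by (auto simp: zero_less_mult_iff)
  then show ?thesis
  proof cases
    case 1
    then have "(1 - t) * a + t * b \<ge> 0" using assms(2,3) by simp
    then show ?thesis using 1 assms(1)[OF assms(2,3)] by simp
  next
    case 2
    then have "(1 - t) * a + t * b \<le> 0"
      using assms(2,3) by (intro add_nonpos_nonpos mult_nonneg_nonpos) auto
    then show ?thesis using 2 assms(1)[OF assms(2,3)] by simp
  qed
qed

text \<open>If the signs agreed, multiplying the equation by \<open>a\<close> would give two
  nonnegative terms with sum \<open>0\<close>, forcing both \<open>t = 1\<close> and
  \<open>t = 0\<close>.\<close>

lemma opposite_signs:
  fixes a b :: real
  assumes "(1 - t) * a + t * b = 0" "0 \<le> t" "t \<le> 1" "a \<noteq> 0" "b \<noteq> 0"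
  shows "a * b < 0"
proof (rule ccontr)
  assume "\<not> a * b < 0"
  then have ab: "a * b > 0" using assms(4,5) by (simp add: not_less order_less_le)
  have "(1 - t) * (a * a) + t * (a * b) = a * ((1 - t) * a + t * b)" by (simp add: algebra_simps)
  then have "(1 - t) * (a * a) + t * (a * b) = 0" using assms(1) by simp
  moreover have "(1 - t) * (a * a) \<ge> 0" "t * (a * b) \<ge> 0" using assms(2,3) ab by auto
  ultimately have "(1 - t) * (a * a) = 0" "t * (a * b) = 0" by linarith+
  then show False using ab assms(4) by auto
qed

theorem lemma5p3:
  fixes \<Delta> :: "('i, 'a::euclidean_space) multi_fan"
    and \<F> :: "'i \<Rightarrow> ('a \<Rightarrow>\<^sub>L real) set"
    and r :: "'i \<Rightarrow> 'a" and v :: 'a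
    and f :: "'i \<Rightarrow> ('a \<Rightarrow>\<^sub>L real)"
    and F :: "('a \<Rightarrow>\<^sub>L real) set"
    and u\<alpha> u\<beta> \<mu> :: "'a \<Rightarrow>\<^sub>L real"
  assumes "is_simple_multi_polytope \<Delta> \<F>"
    and "mf_dim \<Delta> > 1"
    and "ray_vectors \<Delta> r"
    and "generic \<Delta> v"
    and "\<forall>i \<in> mf_rays \<Delta>. f i \<in> \<F> i"
    and "F \<in> \<F> ` mf_rays \<Delta>"
    and "u\<alpha> \<in> dual_space (mf_space \<Delta>) - (\<Union>i \<in> mf_rays \<Delta>. \<F> i)"
    and "u\<beta> \<in> dual_space (mf_space \<Delta>) - (\<Union>i \<in> mf_rays \<Delta>. \<F> i)"
    and "crosses_transversely_at u\<alpha> u\<beta> F \<mu>"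
    and "\<forall>j \<in> mf_rays \<Delta>. \<F> j \<noteq> F \<longrightarrow> closed_segment u\<alpha> u\<beta> \<inter> \<F> j = {}"
  shows "DH \<Delta> \<F> r v u\<alpha> - DH \<Delta> \<F> r v u\<beta> =
    (\<Sum>i \<in> {i \<in> mf_rays \<Delta>. \<F> i = F}.
       sgn (blinfun_apply (u\<beta> - u\<alpha>) (r i)) * DH_facet \<Delta> \<F> r v i (f i) (\<mu> - f i))"
proof -
  have simple: "is_multi_polytope \<Delta> \<F>" "simplicial_fan \<Delta>"
    using assms(1) by (simp_all add: is_simple_multi_polytope_def)
  note polytope = simple(1)[unfolded is_multi_polytope_def]
  interpret simplicial_multi_fan \<Delta> r
    by unfold_locales (fact conjunct1[OF polytope] simple(2) assms(3))+
  let ?D = "dual_space (mf_space \<Delta>)"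
  \<comment> \<open>As \<open>f i\<close> lies on the hyperplane, its value at \<open>r i\<close> is
    the constant in the equation of that hyperplane.\<close>
  define c where "c i = blinfun_apply (f i) (r i)" for i
  have hyp: "\<F> i = {u \<in> ?D. blinfun_apply u (r i) = c i}" if i: "i \<in> mf_rays \<Delta>" for i
    unfolding c_def
  proof (rule affine_hyperplane_dual_space)
    show "affine_hyperplane ?D (\<F> i)"
      using polytope i by blast
    show "blinfun_apply u (r i) = blinfun_apply u' (r i)" if "u \<in> \<F> i" "u' \<in> \<F> i" for u u'
    proof -
      have "r i \<in> mf_cone \<Delta> i" using assms(3) i by (simp add: ray_vectors_def)
      then show ?thesis using polytope i that by blast
    qed
  qed (use i assms(5) ray_in_space[OF i] in \<open>auto simp: mf_space_def\<close>)
  have \<alpha>: "u\<alpha> \<in> ?D" "\<And>i. i \<in> mf_rays \<Delta> \<Longrightarrow> blinfun_apply u\<alpha> (r i) - c i \<noteq> 0"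
    and \<beta>: "u\<beta> \<in> ?D" "\<And>i. i \<in> mf_rays \<Delta> \<Longrightarrow> blinfun_apply u\<beta> (r i) - c i \<noteq> 0"
    using assms(7,8) hyp by auto
  define p where "p t = (1 - t) *\<^sub>R u\<alpha> + t *\<^sub>R u\<beta>" for t :: real
  have p_apply: "blinfun_apply (p t) (r i) - c i =
      (1 - t) * (blinfun_apply u\<alpha> (r i) - c i) + t * (blinfun_apply u\<beta> (r i) - c i)" for t i
    by (simp add: p_def blinfun.bilinear_simps algebra_simps)
  have p_in: "p t \<in> ?D" for t
    unfolding p_def by (intro subspace_add subspace_scale subspace_dual_space \<alpha> \<beta>)
  have "\<mu> \<in> closed_segment u\<alpha> u\<beta>" and \<mu>F: "\<mu> \<in> F"
    using assms(9) by (auto simp: crosses_transversely_at_def)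
  then obtain \<tau> where \<tau>: "0 \<le> \<tau>" "\<tau> \<le> 1" "\<mu> = p \<tau>" by (auto simp: in_segment p_def)
  \<comment> \<open>The signed distance from the wall is affine along the segment, vanishes at
    \<open>\<mu>\<close> and is nonzero at both ends.\<close>
  have jump: "(blinfun_apply u\<alpha> (r i) - c i) * (blinfun_apply u\<beta> (r i) - c i) < 0"
    if "i \<in> mf_rays \<Delta>" "\<F> i = F" for i
    using \<mu>F hyp[OF that(1)] p_apply[of \<tau> i] \<tau> that(2) \<alpha>(2)[OF that(1)] \<beta>(2)[OF that(1)]
    by (intro opposite_signs[of \<tau>]) auto
  have same: "sgn (blinfun_apply u\<alpha> (r i) - c i) = sgn (blinfun_apply \<mu> (r i) - c i) \<and>
      sgn (blinfun_apply u\<beta> (r i) - c i) = sgn (blinfun_apply \<mu> (r i) - c i)"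
    if i: "i \<in> mf_rays \<Delta>" "\<F> i \<noteq> F" for i
  proof -
    have "p t \<notin> \<F> i" if "0 \<le> t" "t \<le> 1" for t
      using assms(10) i that by (auto simp: in_segment p_def disjoint_iff)
    then have *: "(1 - t) * (blinfun_apply u\<alpha> (r i) - c i) + t * (blinfun_apply u\<beta> (r i) - c i) \<noteq> 0"
      if "0 \<le> t" "t \<le> 1" for t
      using that p_in hyp[OF i(1)] p_apply[of t i] by auto
    \<comment> \<open>Parameter \<open>\<tau>\<close> compares the sign at \<open>u\<alpha>\<close>
      with that at \<open>\<mu>\<close>, and parameter \<open>1\<close> compares it with that at
      \<open>u\<beta>\<close>.\<close>
    show ?thesis
      using sgn_no_zero_between[OF *, of \<tau>] sgn_no_zero_between[OF *, of 1] \<tau> p_apply[of \<tau> i] by simp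
  qed
  define w where "w I i u = wall_factor (blinfun_apply (dual_vec \<Delta> r I i) v) (blinfun_apply u (r i) - c i)" for I i u
  let ?T = "mf_level \<Delta> (mf_dim \<Delta>)" and ?A = "{i \<in> mf_rays \<Delta>. \<F> i = F}"
  have DH: "DH \<Delta> \<F> r v u = (\<Sum>I \<in> ?T. mf_weight \<Delta> I * (\<Prod>i \<in> vertices \<Delta> I. w I i u))"
    if "u \<in> ?D" for u
    unfolding DH_def w_def
  proof (rule sum.cong[OF refl])
    fix I assume "I \<in> ?T"
    from dh_term_eq[OF basis_family_top[OF this], of \<F> c u v] that hyp
    show "dh_sign \<Delta> r v I * real_of_int (mf_weight \<Delta> I) * indicator (dh_cone \<Delta> \<F> r v I) u =
      mf_weight \<Delta> I * (\<Prod>i \<in> vertices \<Delta> I.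
        wall_factor (blinfun_apply (dual_vec \<Delta> r I i) v) (blinfun_apply u (r i) - c i))"
      by (simp add: vertices_def mult.commute mult.assoc)
  qed
  have unique: "card {i \<in> vertices \<Delta> I. \<F> i = F} \<le> 1" if I: "I \<in> ?T" for I
  proof -
    have "i = j" if ij: "i \<in> vertices \<Delta> I" "j \<in> vertices \<Delta> I" "\<F> i = F" "\<F> j = F" for i j
    proof (rule ccontr)
      assume "i \<noteq> j"
      \<comment> \<open>Independence of the vectors of a simplex allows a point on the hyperplane of
        \<open>i\<close> that misses the one of \<open>j\<close> by \<open>1\<close>, so the two
        hyperplanes differ.\<close>
      obtain u where "u \<in> ?D" "\<forall>k \<in> vertices \<Delta> I. blinfun_apply u (r k) = (if k = j then c k + 1 else c k)"
        using basis_family_interpolate[OF basis_family_top[OF I],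
            of "\<lambda>k. if k = j then c k + 1 else c k"] by blast
      then have "u \<in> \<F> i" "u \<notin> \<F> j" using ij(1,2) hyp \<open>i \<noteq> j\<close> by (auto simp: vertices_def)
      then show False using ij(3,4) by simp
    qed
    then show ?thesis using finite_vertices[OF fan, of I] by (simp add: card_le_Suc0_iff_eq)
  qed
  have "(\<Prod>i \<in> vertices \<Delta> I. w I i u\<alpha>) - (\<Prod>i \<in> vertices \<Delta> I. w I i u\<beta>) =
      (\<Sum>i \<in> {i \<in> ?A. i \<in> vertices \<Delta> I}. sgn (blinfun_apply (u\<beta> - u\<alpha>) (r i)) *
        (\<Prod>j \<in> vertices \<Delta> I - {i}. w I j \<mu>))" if I: "I \<in> ?T" for I
  proof -
    have rays: "i \<in> mf_rays \<Delta>" if "i \<in> vertices \<Delta> I" for i using that by (simp add: vertices_def)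
    have "{i \<in> ?A. i \<in> vertices \<Delta> I} = {i \<in> vertices \<Delta> I. \<F> i = F}" using rays by auto
    then show ?thesis
      unfolding w_def
      using wall_factor_prod_jump[OF finite_vertices[OF fan] unique[OF I], OF jump[OF rays] same[OF rays],
          where s = "\<lambda>i. blinfun_apply (dual_vec \<Delta> r I i) v"]
      by (simp add: blinfun.diff_left)
  qed
  then have "DH \<Delta> \<F> r v u\<alpha> - DH \<Delta> \<F> r v u\<beta> =
      (\<Sum>I \<in> ?T. mf_weight \<Delta> I * (\<Sum>i \<in> {i \<in> ?A. i \<in> vertices \<Delta> I}.
        sgn (blinfun_apply (u\<beta> - u\<alpha>) (r i)) * (\<Prod>j \<in> vertices \<Delta> I - {i}. w I j \<mu>)))"
    by (simp add: DH[OF \<alpha>(1)] DH[OF \<beta>(1)] sum_subtractf [symmetric] right_diff_distrib [symmetric])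
  also have "\<dots> = (\<Sum>I \<in> ?T. \<Sum>i \<in> {i \<in> ?A. i \<in> vertices \<Delta> I}.
      sgn (blinfun_apply (u\<beta> - u\<alpha>) (r i)) * (mf_weight \<Delta> I * (\<Prod>j \<in> vertices \<Delta> I - {i}. w I j \<mu>)))"
    by (simp add: sum_distrib_left mult.left_commute)
  \<comment> \<open>The incident pairs of a top simplex and a vertex on the wall are regrouped by
    the vertex.\<close>
  also have "\<dots> = (\<Sum>i \<in> ?A. \<Sum>I \<in> {I \<in> ?T. i \<in> vertices \<Delta> I}.
      sgn (blinfun_apply (u\<beta> - u\<alpha>) (r i)) * (mf_weight \<Delta> I * (\<Prod>j \<in> vertices \<Delta> I - {i}. w I j \<mu>)))"
    by (rule sum.swap_restrict) (use is_multi_fanD(2)[OF fan] in \<open>simp_all add: mf_level_def\<close>)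
  also have "\<dots> = (\<Sum>i \<in> ?A.
      sgn (blinfun_apply (u\<beta> - u\<alpha>) (r i)) * DH_facet \<Delta> \<F> r v i (f i) (\<mu> - f i))"
  proof (rule sum.cong[OF refl])
    fix i assume "i \<in> ?A"
    then have i: "i \<in> mf_rays \<Delta>" "f i \<in> \<F> i" "\<mu> \<in> \<F> i" using assms(5) \<mu>F by auto
    \<comment> \<open>The crossing point lies on every hyperplane equal to \<open>F\<close>, so the
      facet formula can be evaluated at \<open>\<mu>\<close> for each such \<open>i\<close>.\<close>
    have facet: "DH_facet \<Delta> \<F> r v i (f i) (\<mu> - f i) = (\<Sum>I \<in> {I \<in> ?T. i \<in> vertices \<Delta> I}.
        mf_weight \<Delta> I * (\<Prod>j \<in> vertices \<Delta> I - {i}. w I j \<mu>))"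
      unfolding w_def by (rule DH_facet_eq[where F = \<F> and c = c, OF _ i]) (fact hyp)
    show "(\<Sum>I \<in> {I \<in> ?T. i \<in> vertices \<Delta> I}. sgn (blinfun_apply (u\<beta> - u\<alpha>) (r i)) *
        (mf_weight \<Delta> I * (\<Prod>j \<in> vertices \<Delta> I - {i}. w I j \<mu>))) =
      sgn (blinfun_apply (u\<beta> - u\<alpha>) (r i)) * DH_facet \<Delta> \<F> r v i (f i) (\<mu> - f i)"
      unfolding facet by (rule sum_distrib_left [symmetric])
  qed
  finally show ?thesis .
qed

end
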